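(* Let $A\in\mathbb{C}^{n\times n}$ be a 2-almost normal matrix with $C=UV^H$, $U,V\in\mathbb{C}^{n\times 2}$, i.e. $C$ has rank 2 and $\Delta(A)=A^HA-AA^H=CA-AC$. If $\mathrm{rank}([U,V])=4$ and $\mathrm{rank}(\Delta(A))=4$, then $$\mathcal{K}_j(A_{AH},[U,V])\subseteq\mathcal{K}_j(A_H,[U,V])\quad\text{for each } j.$$ Hence, if the block Lanczos process applied to $A_H$ with initial matrix $[U,V]$ does not break down, the unitary matrix $Q$ it produces, which transforms $A_H$ to block tridiagonal form $Q^HA_HQ$, also brings $A_{AH}$ to block tridiagonal form $Q^HA_{AH}Q$, and hence $A$ is also brought to block tridiagonal form $Q^HAQ$, with blocks of size at most 4 (all with respect to the block partition produced by the process).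
   Context: $A^H$ is the conjugate transpose of $A$. A matrix $A\in\mathbb{C}^{n\times n}$ is $k$-almost normal if there is a rank-$k$ matrix $C$ with $\Delta(A):=A^HA-AA^H=CA-AC$. The Hermitian and antihermitian parts of $A$ are $A_H=\frac{A+A^H}{2}$ and $A_{AH}=\frac{A-A^H}{2}$. $[U,V]\in\mathbb{C}^{n\times4}$ is the matrix obtained by juxtaposing $U$ and $V$. Block Krylov subspaces: for $H\in\mathbb{C}^{n\times n}$ and $Z\in\mathbb{C}^{n\times\ell}$, $\mathcal{K}_j(H,Z)$ is the span of the columns of $Z,HZ,\dots,H^{j-1}Z$. Block Lanczos process: given a Hermitian $H\in\mathbb{C}^{n\times n}$ and a nonzero $Z\in\mathbb{C}^{n\times \ell}$, $\ell\le n$, let the columns of $Q_1$ be an orthonormal basis of the column space of $Z$. For $k\ge1$, while the total number of columns of $Q_1,\dots,Q_k$ is less than $n$, form $W=HQ_k-Q_kQ_k^HHQ_k-Q_{k-1}Q_{k-1}^HHQ_k$ (the last term is absent for $k=1$). If $W=0$ the process breaks down (premature stop); otherwise the columns of $Q_{k+1}$ are an orthonormal basis of the column space of $W$ (left singular vectors of $W$ for its nonzero singular values). If there is no premature stop, the output is the unitary matrix $Q=[Q_1|\cdots|Q_p]\in\mathbb{C}^{n\times n}$, with $Q_k\in\mathbb{C}^{n\times i_k}$, $\ell\ge i_1\ge i_2\ge\dots\ge i_p$, $i_1+\dots+i_p=n$. "Block tridiagonal" means block tridiagonal with respect to the partition $(i_1,\dots,i_p)$; the block sizes are the $i_k$.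 *)

theory Defs
  imports "Jordan_Normal_Form.DL_Rank" "Jordan_Normal_Form.Schur_Decomposition"
begin

definition hconcat :: "nat \<Rightarrow> complex mat list \<Rightarrow> complex mat" where
  "hconcat n Ms = mat_of_cols n (concat (map cols Ms))"

definition Delta :: "complex mat \<Rightarrow> complex mat" where
  "Delta A = mat_adjoint A * A - A * mat_adjoint A"

text \<open>\<open>C\<close> is a witness for \<open>A\<close> being \<open>k\<close>-almost normal.\<close>

definition almost_normal_with :: "nat \<Rightarrow> nat \<Rightarrow> complex mat \<Rightarrow> complex mat \<Rightarrow> bool" where
  "almost_normal_with n k C A \<longleftrightarrow>
     A \<in> carrier_mat n n \<and> C \<in> carrier_mat n n \<and>
     vec_space.rank n C = k \<and> Delta A = C * A - A * C"

definition hermitian_part :: "complex mat \<Rightarrow> complex mat" where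
  "hermitian_part A = (1/2) \<cdot>\<^sub>m (A + mat_adjoint A)"

definition antihermitian_part :: "complex mat \<Rightarrow> complex mat" where
  "antihermitian_part A = (1/2) \<cdot>\<^sub>m (A - mat_adjoint A)"

definition unitary_mat :: "nat \<Rightarrow> complex mat \<Rightarrow> bool" where
  "unitary_mat n Q \<longleftrightarrow>
     Q \<in> carrier_mat n n \<and> mat_adjoint Q * Q = 1\<^sub>m n \<and> Q * mat_adjoint Q = 1\<^sub>m n"

definition block_krylov :: "nat \<Rightarrow> complex mat \<Rightarrow> complex mat \<Rightarrow> nat \<Rightarrow> complex vec set" where
  "block_krylov n H Z j = vec_space.col_space n (hconcat n (map (\<lambda>i. H ^\<^sub>m i * Z) [0..<j]))"

definition orthonormal_col_basis :: "nat \<Rightarrow> complex mat \<Rightarrow> complex mat \<Rightarrow> bool" where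
  "orthonormal_col_basis n W Q \<longleftrightarrow>
     Q \<in> carrier_mat n (dim_col Q) \<and> mat_adjoint Q * Q = 1\<^sub>m (dim_col Q) \<and>
     vec_space.col_space n Q = vec_space.col_space n W"

text \<open>The matrix \<open>W\<close> formed from the blocks \<open>Q\<^sub>1, \<dots>, Q\<^sub>k\<close> computed so far; only the last two
  blocks enter, and the term for \<open>Q\<^sub>k\<^sub>-\<^sub>1\<close> is absent if \<open>k = 1\<close>.\<close>

definition lanczos_residual :: "complex mat \<Rightarrow> complex mat list \<Rightarrow> complex mat" where
  "lanczos_residual H Qs =
     (let Q = last Qs;
          W = H * Q - Q * mat_adjoint Q * H * Q
      in if length Qs = 1 then W
         else let P = last (butlast Qs) in W - P * mat_adjoint P * H * Q)"

text \<open>\<open>block_lanczos n H Z Qs\<close>: the list \<open>Qs = [Q\<^sub>1, \<dots>, Q\<^sub>k]\<close> can be reached by the block Lanczos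
  process. The choice of the orthonormal bases is left open, so one input admits several runs.\<close>

inductive block_lanczos ::
  "nat \<Rightarrow> complex mat \<Rightarrow> complex mat \<Rightarrow> complex mat list \<Rightarrow> bool"
  for n :: nat and H Z :: "complex mat"
  where
    start: "orthonormal_col_basis n Z Q \<Longrightarrow> block_lanczos n H Z [Q]"
  | step: "\<lbrakk> block_lanczos n H Z Qs; sum_list (map dim_col Qs) < n;
             W = lanczos_residual H Qs; W \<noteq> 0\<^sub>m (dim_row W) (dim_col W);
             orthonormal_col_basis n W Q \<rbrakk>
           \<Longrightarrow> block_lanczos n H Z (Qs @ [Q])"

text \<open>A run that has left the loop, i.e. that has not stopped prematurely because of \<open>W = 0\<close>.\<close>

definition block_lanczos_output ::
  "nat \<Rightarrow> complex mat \<Rightarrow> complex mat \<Rightarrow> complex mat list \<Rightarrow> bool" where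
  "block_lanczos_output n H Z Qs \<longleftrightarrow>
     block_lanczos n H Z Qs \<and> \<not> sum_list (map dim_col Qs) < n"

text \<open>Row (or column) indices of the block number \<open>k\<close>, counted from \<open>0\<close>, for the block
  sizes \<open>is\<close>.\<close>

definition block_indices :: "nat list \<Rightarrow> nat \<Rightarrow> nat set" where
  "block_indices is k = {sum_list (take k is) ..< sum_list (take (Suc k) is)}"

definition block_tridiagonal :: "nat list \<Rightarrow> complex mat \<Rightarrow> bool" where
  "block_tridiagonal is M \<longleftrightarrow>
     M \<in> carrier_mat (sum_list is) (sum_list is) \<and>
     (\<forall>k < length is. \<forall>l < length is. k + 1 < l \<or> l + 1 < k \<longrightarrow>
        (\<forall>i \<in> block_indices is k. \<forall>j \<in> block_indices is l. M $$ (i, j) = 0))"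

end

theory Submission
  imports Defs
begin

text \<open>
  Write \<open>H\<close> and \<open>S\<close> for the Hermitian and the antihermitian part of \<open>A\<close>, so that \<open>A = H + S\<close> and
  \<open>A\<^sup>H = H - S\<close>, and let \<open>Z = [U, V]\<close>. Everything rests on one property of the Krylov subspaces
  \<open>K\<^sub>j\<close> of the pair \<open>(H, Z)\<close>: the matrix \<open>S\<close>, like \<open>H\<close>, maps \<open>K\<^sub>j\<close> into \<open>K\<^sub>j\<^sub>+\<^sub>1\<close>.

  Two facts give this property. Reading \<open>\<Delta>(A) = C A - A C\<close> with \<open>C = U V\<^sup>H\<close> shows that the
  range of \<open>\<Delta>(A)\<close> lies in the span of the columns of \<open>U\<close> and \<open>A U\<close>. These are only four vectors, so
  rank 4 forces equality. As \<open>\<Delta>(A)\<close> is Hermitian, its adjoint gives in the same way the span of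
  the columns of \<open>V\<close> and \<open>A\<^sup>H V\<close>. Hence the range contains the columns of both \<open>U\<close> and \<open>V\<close>, and as
  \<open>[U, V]\<close> has rank 4 too, the range of \<open>\<Delta>(A)\<close> is the column space \<open>K\<^sub>1\<close> of \<open>Z\<close>
  (\<open>col_space_Delta\<close>). In particular \<open>A U\<close> and \<open>A\<^sup>H V\<close> have their columns in \<open>K\<^sub>1\<close>, so that
  \<open>S U = A U - H U\<close> and \<open>S V = H V - A\<^sup>H V\<close> have theirs in \<open>K\<^sub>2\<close>. On the other hand
  \<open>H S - S H = \<Delta>(A) / 2\<close>, so \<open>S\<close> commutes with \<open>H\<close> up to vectors in \<open>K\<^sub>1\<close>. Pushing \<open>S\<close> through
  the powers of \<open>H\<close> proves \<open>S K\<^sub>j \<subseteq> K\<^sub>j\<^sub>+\<^sub>1\<close> by induction on \<open>j\<close>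
  (\<open>mult_block_krylov_if_commutator_in_col_space\<close>), and the inclusion of the Krylov subspaces of \<open>S\<close>
  in those of \<open>H\<close> follows.

  The blocks produced by the block Lanczos process are orthonormal, and the first \<open>k\<close> of them span
  \<open>K\<^sub>k\<close> (\<open>block_lanczos_krylov_blocks\<close>). If the process ends with at least \<open>n\<close> columns, orthonormality
  makes their number exactly \<open>n\<close> and the concatenation unitary. A matrix that maps every \<open>K\<^sub>j\<close> into
  \<open>K\<^sub>j\<^sub>+\<^sub>1\<close> has, in this basis, no entries below the first block subdiagonal. If its adjoint has the
  same property, it is block tridiagonal (\<open>krylov_blocks_block_tridiagonal\<close>). This applies to \<open>H\<close>, to
  \<open>S\<close> and to \<open>A\<close>, since their adjoints are \<open>H\<close>, \<open>-S\<close> and \<open>H - S\<close>.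
\<close>

section \<open>Adjoints and columns of matrices\<close>

lemma mat_adjoint_index:
  assumes "i < dim_col A" "j < dim_row A"
  shows "mat_adjoint A $$ (i, j) = conjugate (A $$ (j, i))"
  using assms by (simp add: mat_adjoint_def mat_of_rows_def)

lemma dim_mat_adjoint [simp]:
  "dim_row (mat_adjoint A) = dim_col A" "dim_col (mat_adjoint A) = dim_row A"
  by (simp_all add: mat_adjoint_def)

lemma mat_adjoint_carrier [simp]:
  "A \<in> carrier_mat nr nc \<Longrightarrow> mat_adjoint A \<in> carrier_mat nc nr"
  by (intro carrier_matI) auto

lemma mat_adjoint_mat_adjoint [simp]: "mat_adjoint (mat_adjoint A) = A"
  by (rule eq_matI) (simp_all add: mat_adjoint_index)

lemma mat_adjoint_zero [simp]: "mat_adjoint (0\<^sub>m nr nc) = 0\<^sub>m nc nr"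
  by (rule eq_matI) (simp_all add: mat_adjoint_index)

lemma mat_adjoint_add:
  assumes "A \<in> carrier_mat nr nc" "B \<in> carrier_mat nr nc"
  shows "mat_adjoint (A + B) = mat_adjoint A + mat_adjoint B"
  using assms by (intro eq_matI) (auto simp: mat_adjoint_index conjugate_dist_add)

lemma mat_adjoint_minus:
  fixes A B :: "complex mat"
  assumes "A \<in> carrier_mat nr nc" "B \<in> carrier_mat nr nc"
  shows "mat_adjoint (A - B) = mat_adjoint A - mat_adjoint B"
  using assms by (intro eq_matI) (auto simp: mat_adjoint_index)

lemma mat_adjoint_smult:
  "mat_adjoint (c \<cdot>\<^sub>m A) = conjugate c \<cdot>\<^sub>m mat_adjoint A"
  by (rule eq_matI) (auto simp: mat_adjoint_index conjugate_dist_mul)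

lemma mat_adjoint_mult:
  fixes A B :: "complex mat"
  assumes "A \<in> carrier_mat nr m" "B \<in> carrier_mat m nc"
  shows "mat_adjoint (A * B) = mat_adjoint B * mat_adjoint A"
  using assms
  by (intro eq_matI) (auto simp: mat_adjoint_index scalar_prod_def mult.commute intro!: sum.cong)

lemma smult_mat_mult_vec:
  fixes M :: "'a :: comm_ring mat"
  assumes "M \<in> carrier_mat nr nc" "x \<in> carrier_vec nc"
  shows "(a \<cdot>\<^sub>m M) *\<^sub>v x = a \<cdot>\<^sub>v (M *\<^sub>v x)"
  using assms
  by (intro eq_vecI) (auto simp: scalar_prod_def sum_distrib_left mult.assoc intro!: sum.cong)

lemma mult_mat_zero_if_cols:
  assumes B: "B \<in> carrier_mat nr m" and X: "X \<in> carrier_mat m nc"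
    and zero: "\<And>x. x \<in> set (cols X) \<Longrightarrow> B *\<^sub>v x = 0\<^sub>v nr"
  shows "B * X = 0\<^sub>m nr nc"
proof (rule eq_matI)
  fix i j assume ij: "i < dim_row (0\<^sub>m nr nc)" "j < dim_col (0\<^sub>m nr nc)"
  then have "col X j \<in> set (cols X)" using X by (auto simp: cols_def)
  from zero[OF this] have "(B *\<^sub>v col X j) $ i = 0" using ij by simp
  then show "(B * X) $$ (i, j) = 0\<^sub>m nr nc $$ (i, j)" using ij B X by simp
qed (use B X in auto)

lemma set_cols_mult:
  assumes "A \<in> carrier_mat nr m" "B \<in> carrier_mat m nc"
  shows "set (cols (A * B)) = (*\<^sub>v) A ` set (cols B)"
proof -
  have "set (cols (A * B)) = (\<lambda>j. col (A * B) j) ` {0..<nc}"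
    using assms by (simp add: cols_def)
  also have "\<dots> = (\<lambda>j. A *\<^sub>v col B j) ` {0..<nc}"
    by (intro image_cong refl col_mult2[OF assms]) simp
  also have "\<dots> = (*\<^sub>v) A ` set (cols B)"
    using assms by (simp add: cols_def image_image)
  finally show ?thesis .
qed

lemma cols_hconcat:
  assumes "\<And>M. M \<in> set Ms \<Longrightarrow> dim_row M = n"
  shows "cols (hconcat n Ms) = concat (map cols Ms)"
  unfolding hconcat_def using assms by (intro cols_mat_of_cols) (auto simp: cols_def intro!: carrier_vecI)

lemma hconcat_carrier: "hconcat n Ms \<in> carrier_mat n (sum_list (map dim_col Ms))"
  unfolding hconcat_def by (intro carrier_matI) (simp_all add: length_concat comp_def)

lemma nth_concat_offset:
  assumes "k < length xss" "a < length (xss ! k)"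
  shows "concat xss ! (sum_list (map length (take k xss)) + a) = xss ! k ! a"
proof -
  have "concat xss = concat (take k xss) @ xss ! k @ concat (drop (Suc k) xss)"
    using id_take_nth_drop[OF assms(1)] by (metis concat.simps(2) concat_append)
  moreover have "length (concat (take k xss)) = sum_list (map length (take k xss))"
    by (simp add: length_concat)
  ultimately show ?thesis using assms(2) by (simp add: nth_append)
qed

lemma nth_concat_exists:
  assumes "i < length (concat xss)"
  shows "\<exists>k a. k < length xss \<and> a < length (xss ! k) \<and> concat xss ! i = xss ! k ! a \<and>
    i = sum_list (map length (take k xss)) + a"
  using assms
proof (induction xss arbitrary: i)
  case Nil
  then show ?case by simp
next
  case (Cons xs xss)
  show ?case
  proof (cases "i < length xs")
    case True
    then show ?thesis by (intro exI[of _ 0] exI[of _ i]) (simp add: nth_append)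
  next
    case False
    then have "i - length xs < length (concat xss)" using Cons.prems by simp
    from Cons.IH[OF this] obtain k a where "k < length xss" "a < length (xss ! k)"
      "concat xss ! (i - length xs) = xss ! k ! a"
      "i - length xs = sum_list (map length (take k xss)) + a" by blast
    with False show ?thesis by (intro exI[of _ "Suc k"] exI[of _ a]) (simp add: nth_append)
  qed
qed

section \<open>Column spaces and ranks\<close>

locale complex_vec_space = vec_space "TYPE(complex)" n for n :: nat
begin

text \<open>The zero vector and single steps \<open>a x + v\<close> suffice, because a linear combination of a finite set is
  built up by inserting one generator after the other.\<close>

lemma span_induct [consumes 2, case_names zero step]:
  assumes v: "v \<in> span X" and X: "X \<subseteq> carrier_vec n"
    and zero: "P (0\<^sub>v n)"
    and step: "\<And>a x v. x \<in> X \<Longrightarrow> v \<in> carrier_vec n \<Longrightarrow> P v \<Longrightarrow> P (a \<cdot>\<^sub>v x + v)"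
  shows "P v"
proof -
  from in_spanE[OF v] obtain a F where F: "v = lincomb a F" "finite F" "F \<subseteq> X" by blast
  from F(2,3) have "P (lincomb a F)"
  proof (induction F rule: finite_induct)
    case empty
    then show ?case using zero by simp
  next
    case (insert x F)
    have "lincomb a (insert x F) = a x \<cdot>\<^sub>v x + lincomb a F"
      using insert X by (intro lincomb_insert2) auto
    moreover have "lincomb a F \<in> carrier_vec n" using insert X by (intro lincomb_closed) auto
    ultimately show ?case using insert step by auto
  qed
  with F show ?thesis by simp
qed

lemma span_minus:
  assumes "X \<subseteq> carrier_vec n" "u \<in> span X" "v \<in> span X"
  shows "u - v \<in> span X"
proof -
  have c: "u \<in> carrier_vec n" "v \<in> carrier_vec n" using assms span_closed by auto
  have "u - v = u + (-1) \<cdot>\<^sub>v v" using c by (intro eq_vecI) auto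
  then show ?thesis using span_add1[OF assms(1,2) smult_in_span[OF assms(1,3), of "-1"]] by simp
qed

lemma mult_mat_vec_span:
  assumes M: "M \<in> carrier_mat n n" and X: "X \<subseteq> carrier_vec n" and Y: "Y \<subseteq> carrier_vec n"
    and gens: "\<And>x. x \<in> X \<Longrightarrow> M *\<^sub>v x \<in> span Y" and v: "v \<in> span X"
  shows "M *\<^sub>v v \<in> span Y"
  using v X
proof (induction rule: span_induct)
  case zero
  have "M *\<^sub>v 0\<^sub>v n = 0\<^sub>v n" using M by (intro eq_vecI) auto
  moreover have "0\<^sub>v n \<in> span Y" by (rule in_spanI[of _ undefined "{}"]) simp_all
  ultimately show ?case by simp
next
  case (step a x v)
  have "x \<in> carrier_vec n" using step X by auto
  then have "M *\<^sub>v (a \<cdot>\<^sub>v x + v) = a \<cdot>\<^sub>v (M *\<^sub>v x) + M *\<^sub>v v"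
    using M step by (simp add: mult_add_distrib_mat_vec[of _ n n] mult_mat_vec[of _ n n])
  then show ?case using step Y gens by (simp add: span_add1 smult_in_span)
qed

lemma mult_mat_vec_span_zero:
  assumes M: "M \<in> carrier_mat m n" and X: "X \<subseteq> carrier_vec n"
    and gens: "\<And>x. x \<in> X \<Longrightarrow> M *\<^sub>v x = 0\<^sub>v m" and v: "v \<in> span X"
  shows "M *\<^sub>v v = 0\<^sub>v m"
  using v X
proof (induction rule: span_induct)
  case zero
  show ?case using M by (intro eq_vecI) auto
next
  case (step a x v)
  have "x \<in> carrier_vec n" using step X by auto
  then have "M *\<^sub>v (a \<cdot>\<^sub>v x + v) = a \<cdot>\<^sub>v (M *\<^sub>v x) + M *\<^sub>v v"
    using M step by (simp add: mult_add_distrib_mat_vec[of _ m n] mult_mat_vec[of _ m n])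
  then show ?case using step gens by (intro eq_vecI) auto
qed

lemma mult_mat_vec_in_col_space:
  assumes "M \<in> carrier_mat n m" "x \<in> carrier_vec m"
  shows "M *\<^sub>v x \<in> col_space M"
  using assms col_space_eq[OF assms(1)] by auto

lemma cols_carrier: "M \<in> carrier_mat n m \<Longrightarrow> set (cols M) \<subseteq> carrier_vec n"
  using cols_dim by blast

lemma cols_subset_col_space: "M \<in> carrier_mat n m \<Longrightarrow> set (cols M) \<subseteq> col_space M"
  unfolding col_space_def by (rule in_own_span[OF cols_carrier])

lemma col_space_mono:
  assumes "set (cols M) \<subseteq> span Y" "Y \<subseteq> carrier_vec n"
  shows "col_space M \<subseteq> span Y"
  unfolding col_space_def using assms by (rule span_subsetI[rotated])

lemma rank_eq_card_independent_subset:
  assumes M: "M \<in> carrier_mat n m"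
  obtains S where "S \<subseteq> set (cols M)" "lin_indpt S" "card S = rank M"
proof -
  obtain S where "maximal S (\<lambda>T. T \<subseteq> set (cols M) \<and> lin_indpt T)"
    using maximal_exists[of "(\<lambda>T. T \<subseteq> set (cols M) \<and> lin_indpt T)" "card (set (cols M))" "{}"]
    by (meson List.finite_set card_mono empty_iff empty_subsetI finite_lin_indpt2 rev_finite_subset)
  with rank_card_indpt[OF M this] show ?thesis by (intro that) (auto simp: maximal_def)
qed

text \<open>A maximal independent set of columns of \<open>X\<close> is independent inside the column space of \<open>Y\<close> and
  has at least as many elements as the dimension of that space, so it is a basis of it.\<close>

lemma col_space_eq_if_rank_le:
  assumes X: "X \<in> carrier_mat n nx" and Y: "Y \<in> carrier_mat n ny"
    and sub: "col_space X \<subseteq> col_space Y" and rk: "rank Y \<le> rank X"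
  shows "col_space X = col_space Y"
proof
  let ?Y = "set (cols Y)"
  interpret Y: vectorspace class_ring "span_vs ?Y"
    using subspace_is_vs[OF span_is_subspace[OF cols_carrier[OF Y]]] .
  obtain S where S: "S \<subseteq> set (cols X)" "lin_indpt S" "card S = rank X"
    using rank_eq_card_independent_subset[OF X] .
  have SY: "S \<subseteq> span ?Y"
    using S(1) sub in_own_span[OF cols_carrier[OF X]] unfolding col_space_def by blast
  have submod: "submodule class_ring (span ?Y) V"
    by (rule span_is_submodule[OF cols_carrier[OF Y]])
  have "Y.basis S"
  proof (rule Y.dim_li_is_basis)
    show "Y.fin_dim" using fin_dim_span_cols[OF Y] .
    show "finite S" using S(1) finite_subset by blast
    show "S \<subseteq> carrier (span_vs ?Y)" using SY by simp
    show "\<not> Y.lin_dep S" using span_li_not_depend(2)[OF SY submod] S(2) by simp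
    show "Y.dim \<le> card S" using rk S(3) unfolding rank_def by simp
  qed
  then have "Y.span S = span ?Y" unfolding Y.basis_def by simp
  then have "span S = span ?Y" using span_li_not_depend(1)[OF SY submod] by simp
  then show "col_space Y \<subseteq> col_space X"
    unfolding col_space_def using span_is_monotone[OF S(1)] by simp
qed (rule sub)

text \<open>A left inverse \<open>B\<close> recovers every coefficient vector: \<open>B Q v = v\<close>, so \<open>Q v = 0\<close> only for
  \<open>v = 0\<close>, and equal columns would be mapped by \<open>B\<close> to two different unit vectors.\<close>

lemma cols_independent_if_left_inverse:
  fixes Q B :: "complex mat"
  assumes Q: "Q \<in> carrier_mat n m" and B: "B \<in> carrier_mat m n" and inv: "B * Q = 1\<^sub>m m"
  shows "distinct (cols Q)" "lin_indpt (set (cols Q))"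
proof -
  have unit: "B *\<^sub>v col Q i = unit_vec m i" if "i < m" for i
  proof -
    have "B *\<^sub>v col Q i = col (B * Q) i" by (rule col_mult2[OF B Q that, symmetric])
    then show ?thesis using inv that by simp
  qed
  show d: "distinct (cols Q)"
    unfolding distinct_conv_nth
  proof (intro allI impI)
    fix i j assume "i < length (cols Q)" "j < length (cols Q)" "i \<noteq> j"
    then show "cols Q ! i \<noteq> cols Q ! j" using unit[of i] unit[of j] Q
      by (metis carrier_matD(2) cols_length cols_nth unit_vec_eq)
  qed
  show "lin_indpt (set (cols Q))"
  proof
    assume "lin_dep (set (cols Q))"
    then obtain v where v: "v \<in> carrier_vec m" "v \<noteq> 0\<^sub>v m" "Q *\<^sub>v v = 0\<^sub>v n"
      using lin_depE[OF Q _ d] by blast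
    have "v = (B * Q) *\<^sub>v v" using inv v by simp
    also have "\<dots> = B *\<^sub>v (Q *\<^sub>v v)" using B Q v by (intro assoc_mult_mat_vec)
    also have "\<dots> = 0\<^sub>v m" using v B by (intro eq_vecI) auto
    finally show False using v by simp
  qed
qed

lemma dim_col_le_if_left_inverse:
  fixes Q B :: "complex mat"
  assumes Q: "Q \<in> carrier_mat n m" and B: "B \<in> carrier_mat m n" and inv: "B * Q = 1\<^sub>m m"
  shows "m \<le> n"
proof -
  note ind = cols_independent_if_left_inverse[OF Q B inv]
  have "card (set (cols Q)) \<le> dim"
    using li_le_dim(2)[OF fin_dim _ ind(2)] cols_carrier[OF Q] by simp
  then show ?thesis using ind(1) Q dim_is_n by (simp add: distinct_card)
qed

text \<open>The source of the bound on the block sizes: the number of basis vectors is the rank of \<open>W\<close>.\<close>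

lemma orthonormal_col_basis_dim_col_le:
  assumes Q: "orthonormal_col_basis n W Q" and W: "W \<in> carrier_mat n m"
  shows "dim_col Q \<le> m"
proof -
  have c: "Q \<in> carrier_mat n (dim_col Q)" and o: "mat_adjoint Q * Q = 1\<^sub>m (dim_col Q)"
    and eq: "col_space Q = col_space W" using Q unfolding orthonormal_col_basis_def by auto
  have "dim_col Q = rank Q"
    using cols_independent_if_left_inverse[OF c mat_adjoint_carrier[OF c] o]
    by (intro lin_indpt_full_rank[symmetric, OF c])
  also have "\<dots> = rank W" using eq unfolding rank_def col_space_def by simp
  also have "\<dots> \<le> m" using rank_le_nc[OF W] .
  finally show ?thesis .
qed

section \<open>Block Krylov subspaces\<close>

definition krylov_gens :: "complex mat \<Rightarrow> complex mat \<Rightarrow> nat \<Rightarrow> complex vec set" where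
  "krylov_gens H Z j = (\<Union>i<j. (*\<^sub>v) (H ^\<^sub>m i) ` set (cols Z))"

context
  fixes H Z :: "complex mat" and m :: nat
  assumes H: "H \<in> carrier_mat n n" and Z: "Z \<in> carrier_mat n m"
begin

lemma krylov_gens_carrier: "krylov_gens H Z j \<subseteq> carrier_vec n"
proof -
  have "H ^\<^sub>m i *\<^sub>v z \<in> carrier_vec n" if "z \<in> set (cols Z)" for i z
    using that H cols_carrier[OF Z] by (meson mult_mat_vec_carrier pow_carrier_mat subsetD)
  then show ?thesis unfolding krylov_gens_def by auto
qed

lemma block_krylov_eq_span: "block_krylov n H Z j = span (krylov_gens H Z j)"
proof -
  let ?Ms = "map (\<lambda>i. H ^\<^sub>m i * Z) [0..<j]"
  have "cols (hconcat n ?Ms) = concat (map cols ?Ms)"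
    using H by (intro cols_hconcat) auto
  moreover have "set (cols (H ^\<^sub>m i * Z)) = (*\<^sub>v) (H ^\<^sub>m i) ` set (cols Z)" for i
    using H Z by (intro set_cols_mult[of _ n n _ m]) auto
  ultimately have "set (cols (hconcat n ?Ms)) = krylov_gens H Z j"
    unfolding krylov_gens_def by auto
  then show ?thesis unfolding block_krylov_def col_space_def by simp
qed

lemma block_krylov_minus:
  "u \<in> block_krylov n H Z j \<Longrightarrow> v \<in> block_krylov n H Z j \<Longrightarrow> u - v \<in> block_krylov n H Z j"
  unfolding block_krylov_eq_span by (rule span_minus[OF krylov_gens_carrier])

lemma block_krylov_add:
  "u \<in> block_krylov n H Z j \<Longrightarrow> v \<in> block_krylov n H Z j \<Longrightarrow> u + v \<in> block_krylov n H Z j"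
  unfolding block_krylov_eq_span by (rule span_add1[OF krylov_gens_carrier])

lemma block_krylov_smult:
  "u \<in> block_krylov n H Z j \<Longrightarrow> a \<cdot>\<^sub>v u \<in> block_krylov n H Z j"
  unfolding block_krylov_eq_span by (rule smult_in_span[OF krylov_gens_carrier])

lemma block_krylov_mono:
  assumes "i \<le> j" shows "block_krylov n H Z i \<subseteq> block_krylov n H Z j"
  unfolding block_krylov_eq_span using assms
  by (intro span_is_monotone) (fastforce simp: krylov_gens_def)

lemma block_krylov_carrier: "block_krylov n H Z j \<subseteq> carrier_vec n"
  unfolding block_krylov_eq_span using krylov_gens_carrier span_closed by blast

text \<open>This recursion peels off the factor \<open>H\<close> on the left, where the defining powers
  \<open>H ^\<^sub>m Suc i = H ^\<^sub>m i * H\<close> carry it on the right.\<close>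

lemma krylov_gens_Suc:
  "krylov_gens H Z (Suc j) = set (cols Z) \<union> (*\<^sub>v) H ` krylov_gens H Z j"
proof -
  have pow: "H ^\<^sub>m Suc i = H * H ^\<^sub>m i" for i
  proof (induction i)
    case 0
    then show ?case using H by simp
  next
    case (Suc i)
    then show ?case using H by (simp add: assoc_mult_mat[of _ n n _ n _ n])
  qed
  have one: "1\<^sub>m n *\<^sub>v z = z" if "z \<in> set (cols Z)" for z
    using that cols_carrier[OF Z] by auto
  have mult: "H ^\<^sub>m Suc i *\<^sub>v z = H *\<^sub>v (H ^\<^sub>m i *\<^sub>v z)" if "z \<in> set (cols Z)" for i z
    unfolding pow using that cols_carrier[OF Z] H
    by (intro assoc_mult_mat_vec[of _ n n _ n]) auto
  have zero: "H ^\<^sub>m 0 *\<^sub>v z = z" if "z \<in> set (cols Z)" for z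
    using that one H by simp
  have "krylov_gens H Z (Suc j)
      = (*\<^sub>v) (H ^\<^sub>m 0) ` set (cols Z) \<union> (\<Union>i<j. (*\<^sub>v) (H ^\<^sub>m Suc i) ` set (cols Z))"
    unfolding krylov_gens_def lessThan_Suc_eq_insert_0 by auto
  also have "(*\<^sub>v) (H ^\<^sub>m 0) ` set (cols Z) = set (cols Z)"
    using zero by (simp cong: image_cong)
  also have "(\<Union>i<j. (*\<^sub>v) (H ^\<^sub>m Suc i) ` set (cols Z)) = (*\<^sub>v) H ` krylov_gens H Z j"
    unfolding krylov_gens_def image_UN image_image using mult by (simp del: pow_mat.simps cong: image_cong)
  finally show ?thesis .
qed

lemma col_space_subset_block_krylov: "col_space Z \<subseteq> block_krylov n H Z (Suc j)"
  unfolding block_krylov_eq_span col_space_def by (intro span_is_monotone) (simp add: krylov_gens_Suc)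

lemma block_krylov_1: "block_krylov n H Z (Suc 0) = col_space Z"
  unfolding block_krylov_eq_span col_space_def krylov_gens_Suc by (simp add: krylov_gens_def)

lemma mult_block_krylov:
  assumes "v \<in> block_krylov n H Z j"
  shows "H *\<^sub>v v \<in> block_krylov n H Z (Suc j)"
  unfolding block_krylov_eq_span
proof (rule mult_mat_vec_span[OF H krylov_gens_carrier krylov_gens_carrier])
  show "v \<in> span (krylov_gens H Z j)" using assms by (simp add: block_krylov_eq_span)
  show "H *\<^sub>v x \<in> span (krylov_gens H Z (Suc j))" if "x \<in> krylov_gens H Z j" for x
    using that in_own_span[OF krylov_gens_carrier] by (fastforce simp: krylov_gens_Suc)
qed

text \<open>Minimality of Krylov subspaces, in the form used to show that a given span contains one.\<close>

lemma block_krylov_Suc_least: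
  assumes T: "T \<subseteq> carrier_vec n" and start: "set (cols Z) \<subseteq> span T"
    and mult: "\<And>v. v \<in> block_krylov n H Z j \<Longrightarrow> H *\<^sub>v v \<in> span T"
  shows "block_krylov n H Z (Suc j) \<subseteq> span T"
  unfolding block_krylov_eq_span krylov_gens_Suc
proof (rule span_subsetI[OF T], intro Un_least start image_subsetI)
  fix x assume "x \<in> krylov_gens H Z j"
  then have "x \<in> block_krylov n H Z j"
    unfolding block_krylov_eq_span using in_own_span[OF krylov_gens_carrier] by blast
  then show "H *\<^sub>v x \<in> span T" by (rule mult)
qed

text \<open>By induction on \<open>j\<close>. The generators of the next Krylov subspace are columns \<open>z\<close> of \<open>Z\<close>, covered
  by \<open>start\<close>, and vectors \<open>H y\<close> with \<open>y\<close> a previous generator. For the latter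
  \<open>S H y = H (S y) - (H S y - S H y)\<close>: the first term gains one step from the induction hypothesis
  and one from \<open>H\<close>, the second stays in the column space of \<open>Z\<close>.\<close>

lemma mult_block_krylov_if_commutator_in_col_space:
  assumes S: "S \<in> carrier_mat n n"
    and start: "\<And>z. z \<in> set (cols Z) \<Longrightarrow> S *\<^sub>v z \<in> block_krylov n H Z 2"
    and comm: "\<And>x. x \<in> carrier_vec n \<Longrightarrow> H *\<^sub>v (S *\<^sub>v x) - S *\<^sub>v (H *\<^sub>v x) \<in> col_space Z"
    and v: "v \<in> block_krylov n H Z j"
  shows "S *\<^sub>v v \<in> block_krylov n H Z (Suc j)"
  using v
proof (induction j arbitrary: v)
  case 0
  then have "v \<in> span {}" by (simp add: block_krylov_eq_span krylov_gens_def)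
  then show ?case unfolding block_krylov_eq_span
    by (rule mult_mat_vec_span[OF S _ krylov_gens_carrier, rotated 2]) auto
next
  case (Suc j)
  show ?case unfolding block_krylov_eq_span
  proof (rule mult_mat_vec_span[OF S krylov_gens_carrier krylov_gens_carrier])
    show "v \<in> span (krylov_gens H Z (Suc j))" using Suc.prems by (simp add: block_krylov_eq_span)
    fix x assume "x \<in> krylov_gens H Z (Suc j)"
    then consider "x \<in> set (cols Z)" | y where "y \<in> krylov_gens H Z j" "x = H *\<^sub>v y"
      unfolding krylov_gens_Suc by auto
    then show "S *\<^sub>v x \<in> span (krylov_gens H Z (Suc (Suc j)))"
    proof cases
      case 1
      then show ?thesis
        using start block_krylov_mono[of 2 "Suc (Suc j)"] by (auto simp: block_krylov_eq_span)
    next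
      case 2
      have y: "y \<in> carrier_vec n" using 2 krylov_gens_carrier by auto
      have "y \<in> block_krylov n H Z j"
        unfolding block_krylov_eq_span using 2 in_own_span[OF krylov_gens_carrier] by blast
      then have HS: "H *\<^sub>v (S *\<^sub>v y) \<in> block_krylov n H Z (Suc (Suc j))"
        by (intro mult_block_krylov Suc.IH)
      have c: "H *\<^sub>v (S *\<^sub>v y) - S *\<^sub>v (H *\<^sub>v y) \<in> block_krylov n H Z (Suc (Suc j))"
        using comm[OF y] col_space_subset_block_krylov by blast
      have "H *\<^sub>v (S *\<^sub>v y) - (H *\<^sub>v (S *\<^sub>v y) - S *\<^sub>v (H *\<^sub>v y)) = S *\<^sub>v (H *\<^sub>v y)"
        using H S y by (intro eq_vecI) auto
      then show ?thesis
        using span_minus[OF krylov_gens_carrier HS[unfolded block_krylov_eq_span]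
            c[unfolded block_krylov_eq_span]] 2 by simp
    qed
  qed
qed

end

text \<open>By induction: each step of \<open>S\<close> leads from one Krylov subspace of \<open>H\<close> into the next.\<close>

lemma block_krylov_subset_if_mult:
  assumes H: "H \<in> carrier_mat n n" and S: "S \<in> carrier_mat n n" and Z: "Z \<in> carrier_mat n m"
    and mult: "\<And>j v. v \<in> block_krylov n H Z j \<Longrightarrow> S *\<^sub>v v \<in> block_krylov n H Z (Suc j)"
  shows "block_krylov n S Z j \<subseteq> block_krylov n H Z j"
proof (induction j)
  case 0
  then show ?case by (simp add: block_krylov_def)
next
  case (Suc j)
  show ?case unfolding block_krylov_eq_span[OF H Z]
  proof (rule block_krylov_Suc_least[OF S Z krylov_gens_carrier[OF H Z]])
    show "set (cols Z) \<subseteq> span (krylov_gens H Z (Suc j))"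
      using in_own_span[OF krylov_gens_carrier[OF H Z]] by (fastforce simp: krylov_gens_Suc[OF H Z])
    show "S *\<^sub>v v \<in> span (krylov_gens H Z (Suc j))" if "v \<in> block_krylov n S Z j" for v
      using mult[of v j] Suc that by (auto simp: block_krylov_eq_span[OF H Z])
  qed
qed

section \<open>Block Lanczos runs compute orthonormal bases of the Krylov subspaces\<close>

definition block_span :: "complex mat list \<Rightarrow> complex vec set" where
  "block_span Qs = span (\<Union>Q\<in>set Qs. set (cols Q))"

definition orthonormal_blocks :: "complex mat list \<Rightarrow> bool" where
  "orthonormal_blocks Qs \<longleftrightarrow>
     (\<forall>Q\<in>set Qs. Q \<in> carrier_mat n (dim_col Q)) \<and>
     (\<forall>i<length Qs. \<forall>j<length Qs. mat_adjoint (Qs ! i) * Qs ! j =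
        (if i = j then 1\<^sub>m (dim_col (Qs ! i)) else 0\<^sub>m (dim_col (Qs ! i)) (dim_col (Qs ! j))))"

text \<open>The invariant of the block Lanczos process. The trivial case \<open>k = 0\<close> is included so that
  orthogonality to \<open>K\<^sub>k\<close> can be stated uniformly for all blocks, the first one among them.\<close>

definition krylov_blocks :: "complex mat \<Rightarrow> complex mat \<Rightarrow> complex mat list \<Rightarrow> bool" where
  "krylov_blocks H Z Qs \<longleftrightarrow> Qs \<noteq> [] \<and> orthonormal_blocks Qs \<and>
     (\<forall>k\<le>length Qs. block_span (take k Qs) = block_krylov n H Z k)"

lemma orthonormal_blocks_carrier:
  "orthonormal_blocks Qs \<Longrightarrow> i < length Qs \<Longrightarrow> Qs ! i \<in> carrier_mat n (dim_col (Qs ! i))"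
  unfolding orthonormal_blocks_def by auto

lemma orthonormal_blocks_mult:
  "orthonormal_blocks Qs \<Longrightarrow> i < length Qs \<Longrightarrow> j < length Qs \<Longrightarrow> mat_adjoint (Qs ! i) * Qs ! j =
        (if i = j then 1\<^sub>m (dim_col (Qs ! i)) else 0\<^sub>m (dim_col (Qs ! i)) (dim_col (Qs ! j)))"
  unfolding orthonormal_blocks_def by auto

lemma block_gens_carrier:
  assumes "orthonormal_blocks Qs"
  shows "(\<Union>Q\<in>set (take k Qs). set (cols Q)) \<subseteq> carrier_vec n"
  using assms cols_carrier unfolding orthonormal_blocks_def by (blast dest: in_set_takeD)

text \<open>The block \<open>Q\<^sub>j\<close>, counted from \<open>0\<close>, is orthogonal to all earlier blocks, and these span \<open>K\<^sub>j\<close>.\<close>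

lemma mat_adjoint_mult_krylov_zero:
  assumes Qs: "krylov_blocks H Z Qs" and v: "v \<in> block_krylov n H Z k"
    and kj: "k \<le> j" "j < length Qs"
  shows "mat_adjoint (Qs ! j) *\<^sub>v v = 0\<^sub>v (dim_col (Qs ! j))"
proof -
  have o: "orthonormal_blocks Qs" using Qs by (simp add: krylov_blocks_def)
  have "v \<in> block_span (take k Qs)" using Qs v kj unfolding krylov_blocks_def by auto
  then have v': "v \<in> span (\<Union>Q\<in>set (take k Qs). set (cols Q))" unfolding block_span_def .
  show ?thesis
  proof (rule mult_mat_vec_span_zero[OF mat_adjoint_carrier[OF orthonormal_blocks_carrier[OF o kj(2)]]
        block_gens_carrier[OF o] _ v'])
    fix x assume "x \<in> (\<Union>Q\<in>set (take k Qs). set (cols Q))"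
    then obtain i c where i: "i < k" "i < length Qs" "c < dim_col (Qs ! i)" "x = col (Qs ! i) c"
      by (auto simp: in_set_conv_nth)
    have "mat_adjoint (Qs ! j) *\<^sub>v x = col (mat_adjoint (Qs ! j) * Qs ! i) c"
      unfolding i(4)
      by (rule col_mult2[OF mat_adjoint_carrier[OF orthonormal_blocks_carrier[OF o kj(2)]]
            orthonormal_blocks_carrier[OF o i(2)] i(3), symmetric])
    then show "mat_adjoint (Qs ! j) *\<^sub>v x = 0\<^sub>v (dim_col (Qs ! j))"
      using i kj by (simp add: orthonormal_blocks_mult[OF o])
  qed
qed

lemma col_in_block_krylov:
  assumes Qs: "krylov_blocks H Z Qs" and i: "i < length Qs" and x: "x \<in> set (cols (Qs ! i))"
  shows "x \<in> block_krylov n H Z (Suc i)"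
proof -
  have o: "orthonormal_blocks Qs" using Qs by (simp add: krylov_blocks_def)
  have "x \<in> block_span (take (Suc i) Qs)"
    unfolding block_span_def
  proof (rule subsetD[OF in_own_span[OF block_gens_carrier[OF o]]])
    show "x \<in> (\<Union>Q\<in>set (take (Suc i) Qs). set (cols Q))"
      using x i by (simp add: take_Suc_conv_app_nth)
  qed
  moreover have "block_span (take (Suc i) Qs) = block_krylov n H Z (Suc i)"
    using Qs i unfolding krylov_blocks_def by (simp add: Suc_leI)
  ultimately show ?thesis by simp
qed

lemma projection_mult:
  fixes P H Q :: "complex mat"
  assumes P: "P \<in> carrier_mat n r" and H: "H \<in> carrier_mat n n" and Q: "Q \<in> carrier_mat n m"
  shows "P * mat_adjoint P * H * Q = P * (mat_adjoint P * (H * Q))"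
    and "mat_adjoint P * (H * Q) \<in> carrier_mat r m"
    and "P * (mat_adjoint P * (H * Q)) \<in> carrier_mat n m"
proof -
  note aP = mat_adjoint_carrier[OF P] and HQ = mult_carrier_mat[OF H Q]
  show aHQ: "mat_adjoint P * (H * Q) \<in> carrier_mat r m" by (rule mult_carrier_mat[OF aP HQ])
  show "P * (mat_adjoint P * (H * Q)) \<in> carrier_mat n m" by (rule mult_carrier_mat[OF P aHQ])
  show "P * mat_adjoint P * H * Q = P * (mat_adjoint P * (H * Q))"
    using assoc_mult_mat[OF mult_carrier_mat[OF P aP] H Q] assoc_mult_mat[OF P aP HQ] by simp
qed

text \<open>Reassociated so that both correction terms are visibly orthogonal projections of \<open>H Q\<^sub>q\<close>, onto the
  column spaces of the last block and of the one before it.\<close>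

lemma lanczos_residual_eq:
  assumes Qs: "orthonormal_blocks Qs" and H: "H \<in> carrier_mat n n"
    and len: "length Qs = Suc q"
  shows "lanczos_residual H Qs =
    (let W = H * Qs ! q - Qs ! q * (mat_adjoint (Qs ! q) * (H * Qs ! q))
     in if q = 0 then W else W - Qs ! (q - 1) * (mat_adjoint (Qs ! (q - 1)) * (H * Qs ! q)))"
proof -
  have c: "Qs ! i \<in> carrier_mat n (dim_col (Qs ! i))" if "i \<le> q" for i
    using orthonormal_blocks_carrier[OF Qs] len that by simp
  have "last Qs = Qs ! q" using len by (cases Qs rule: rev_cases) (auto simp: nth_append)
  moreover have "last (butlast Qs) = Qs ! (q - 1)" if "q \<noteq> 0"
  proof -
    have "butlast Qs \<noteq> []" using len that by (cases Qs rule: rev_cases) auto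
    then show ?thesis using len that by (simp add: last_conv_nth nth_butlast)
  qed
  ultimately show ?thesis
    using len projection_mult(1)[OF c H c, of q q] projection_mult(1)[OF c H c, of "q - 1" q]
    unfolding lanczos_residual_def Let_def by (cases "q = 0") simp_all
qed

lemma mult_in_block_span:
  assumes Qs: "orthonormal_blocks Qs" and i: "i < length Qs" and a: "a \<in> carrier_vec (dim_col (Qs ! i))"
  shows "Qs ! i *\<^sub>v a \<in> block_span Qs"
proof -
  have "col_space (Qs ! i) \<subseteq> block_span Qs"
    unfolding col_space_def block_span_def using nth_mem[OF i] by (intro span_is_monotone) blast
  then show ?thesis
    using mult_mat_vec_in_col_space[OF orthonormal_blocks_carrier[OF Qs i] a] by blast
qed

lemma lanczos_residual_carrier:
  assumes Qs: "orthonormal_blocks Qs" and H: "H \<in> carrier_mat n n" and len: "length Qs = Suc q"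
  shows "lanczos_residual H Qs \<in> carrier_mat n (dim_col (Qs ! q))"
proof -
  have c: "Qs ! i \<in> carrier_mat n (dim_col (Qs ! i))" if "i \<le> q" for i
    using orthonormal_blocks_carrier[OF Qs] len that by simp
  show ?thesis
    unfolding lanczos_residual_eq[OF Qs H len] Let_def
    using projection_mult(3)[OF c H c, of q q] projection_mult(3)[OF c H c, of "q - 1" q]
    by (cases "q = 0") (simp_all add: minus_carrier_mat)
qed

text \<open>The residual and \<open>H Q\<^sub>q\<close> agree columnwise modulo the span of the blocks computed so far. Hence either
  of them extends that span to the next Krylov subspace.\<close>

lemma lanczos_residual_col:
  assumes Qs: "orthonormal_blocks Qs" and H: "H \<in> carrier_mat n n" and len: "length Qs = Suc q"
    and c: "c < dim_col (Qs ! q)"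
  obtains t where "t \<in> block_span Qs" "t \<in> carrier_vec n"
    "H *\<^sub>v col (Qs ! q) c = col (lanczos_residual H Qs) c + t"
proof -
  let ?m = "dim_col (Qs ! q)"
  define y where "y = H *\<^sub>v col (Qs ! q) c"
  have C: "Qs ! i \<in> carrier_mat n (dim_col (Qs ! i))" if "i \<le> q" for i
    using orthonormal_blocks_carrier[OF Qs] len that by simp
  define p where "p i = Qs ! i *\<^sub>v (mat_adjoint (Qs ! i) *\<^sub>v y)" for i
  have y: "y \<in> carrier_vec n" unfolding y_def by (rule mult_mat_vec_carrier[OF H col_carrier_vec[OF c C[OF order_refl]]])
  have HQ: "H * Qs ! q \<in> carrier_mat n ?m" by (rule mult_carrier_mat[OF H C[OF order_refl]])
  have col_HQ: "col (H * Qs ! q) c = y" unfolding y_def by (rule col_mult2[OF H C[OF order_refl] c])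
  have p: "p i \<in> block_span Qs" "p i \<in> carrier_vec n"
    "Qs ! i * (mat_adjoint (Qs ! i) * (H * Qs ! q)) \<in> carrier_mat n ?m"
    "col (Qs ! i * (mat_adjoint (Qs ! i) * (H * Qs ! q))) c = p i" if "i \<le> q" for i
  proof -
    note Ci = C[OF that]
    have aQ: "mat_adjoint (Qs ! i) * (H * Qs ! q) \<in> carrier_mat (dim_col (Qs ! i)) ?m"
      by (rule projection_mult(2)[OF Ci H C[OF order_refl]])
    have ay: "mat_adjoint (Qs ! i) *\<^sub>v y \<in> carrier_vec (dim_col (Qs ! i))"
      by (rule mult_mat_vec_carrier[OF mat_adjoint_carrier[OF Ci] y])
    show "p i \<in> block_span Qs" unfolding p_def
      using that len by (intro mult_in_block_span[OF Qs _ ay]) simp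
    show "p i \<in> carrier_vec n" unfolding p_def by (rule mult_mat_vec_carrier[OF Ci ay])
    show "Qs ! i * (mat_adjoint (Qs ! i) * (H * Qs ! q)) \<in> carrier_mat n ?m"
      by (rule mult_carrier_mat[OF Ci aQ])
    show "col (Qs ! i * (mat_adjoint (Qs ! i) * (H * Qs ! q))) c = p i"
      unfolding p_def col_mult2[OF Ci aQ c] col_mult2[OF mat_adjoint_carrier[OF Ci] HQ c] col_HQ ..
  qed
  have W: "lanczos_residual H Qs = (let W = H * Qs ! q - Qs ! q * (mat_adjoint (Qs ! q) * (H * Qs ! q))
     in if q = 0 then W else W - Qs ! (q - 1) * (mat_adjoint (Qs ! (q - 1)) * (H * Qs ! q)))"
    by (rule lanczos_residual_eq[OF Qs H len])
  have col_minus: "col (X - Y) c = col X c - col Y c"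
    if "X \<in> carrier_mat n ?m" "Y \<in> carrier_mat n ?m" for X Y :: "complex mat"
    using that c by (intro eq_vecI) auto
  show ?thesis
  proof (cases "q = 0")
    case True
    have "y - p q = col (lanczos_residual H Qs) c"
      unfolding W Let_def using True p[of q] HQ col_HQ by (simp add: col_minus)
    moreover have "y = (y - p q) + p q" using p(2)[of q] y by (intro eq_vecI) auto
    ultimately show ?thesis
      using p(1,2)[of q] unfolding y_def by (intro that[of "p q"]) auto
  next
    case False
    have "y - p q - p (q - 1) = col (lanczos_residual H Qs) c"
      unfolding W Let_def using False p[of q] p[of "q - 1"] HQ col_HQ
      by (simp add: col_minus[OF minus_carrier_mat] col_minus)
    moreover have "p q + p (q - 1) \<in> block_span Qs"
      using p[of q] p[of "q - 1"] orthonormal_blocks_def Qs block_gens_carrier[OF Qs, of "length Qs"]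
      unfolding block_span_def by (simp add: span_add1)
    moreover have "y = (y - p q - p (q - 1)) + (p q + p (q - 1))"
      using p(2)[of q] p(2)[of "q - 1"] y by (intro eq_vecI) auto
    ultimately show ?thesis
      using p(2)[of q] p(2)[of "q - 1"] unfolding y_def by (intro that[of "p q + p (q - 1)"]) auto
  qed
qed

text \<open>Subtracting two projections is enough to make the residual orthogonal to all blocks: for
  \<open>i + 1 < q\<close> the vectors \<open>H Q\<^sub>i\<close> lie in the span of \<open>Q\<^sub>0, \<dots>, Q\<^sub>i\<^sub>+\<^sub>1\<close>, which is orthogonal to
  \<open>Q\<^sub>q\<close>. As \<open>H\<close> is Hermitian, this says \<open>Q\<^sub>i\<^sup>H H Q\<^sub>q = 0\<close>.\<close>

lemma mat_adjoint_mult_lanczos_residual: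
  assumes Qs: "krylov_blocks H Z Qs" and H: "H \<in> carrier_mat n n" and herm: "mat_adjoint H = H"
    and Z: "Z \<in> carrier_mat n m"
    and len: "length Qs = Suc q" and i: "i \<le> q"
  shows "mat_adjoint (Qs ! i) * lanczos_residual H Qs = 0\<^sub>m (dim_col (Qs ! i)) (dim_col (Qs ! q))"
proof -
  have o: "orthonormal_blocks Qs" using Qs by (simp add: krylov_blocks_def)
  let ?m = "dim_col (Qs ! q)" and ?r = "dim_col (Qs ! i)"
  have C: "Qs ! j \<in> carrier_mat n (dim_col (Qs ! j))" if "j \<le> q" for j
    using orthonormal_blocks_carrier[OF o] len that by simp
  note Ci = C[OF i] and aCi = mat_adjoint_carrier[OF C[OF i]]
  have HQ: "H * Qs ! q \<in> carrier_mat n ?m" by (rule mult_carrier_mat[OF H C[OF order_refl]])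
  define X where "X = mat_adjoint (Qs ! i) * (H * Qs ! q)"
  have X: "X \<in> carrier_mat ?r ?m" unfolding X_def by (rule mult_carrier_mat[OF aCi HQ])
  define p where "p j = Qs ! j * (mat_adjoint (Qs ! j) * (H * Qs ! q))" for j
  have p: "p j \<in> carrier_mat n ?m"
    "mat_adjoint (Qs ! i) * p j = (if i = j then X else 0\<^sub>m ?r ?m)" if "j \<le> q" for j
  proof -
    note Cj = C[OF that]
    have aQ: "mat_adjoint (Qs ! j) * (H * Qs ! q) \<in> carrier_mat (dim_col (Qs ! j)) ?m"
      by (rule projection_mult(2)[OF Cj H C[OF order_refl]])
    show "p j \<in> carrier_mat n ?m" unfolding p_def by (rule mult_carrier_mat[OF Cj aQ])
    have "mat_adjoint (Qs ! i) * p j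
        = mat_adjoint (Qs ! i) * Qs ! j * (mat_adjoint (Qs ! j) * (H * Qs ! q))"
      unfolding p_def by (rule assoc_mult_mat[OF aCi Cj aQ, symmetric])
    also have "\<dots> = (if i = j then X else 0\<^sub>m ?r ?m)"
      using orthonormal_blocks_mult[OF o, of i j] len i that aQ X unfolding X_def by auto
    finally show "mat_adjoint (Qs ! i) * p j = (if i = j then X else 0\<^sub>m ?r ?m)" .
  qed
  have far: "X = 0\<^sub>m ?r ?m" if "Suc i < q"
  proof -
    \<comment> \<open>Orthogonality is available for \<open>Q\<^sub>q\<close> against \<open>H Q\<^sub>i\<close>; the adjoint turns it into the claim.\<close>
    have "mat_adjoint (Qs ! q) * (H * Qs ! i) = 0\<^sub>m ?m ?r"
    proof (rule mult_mat_zero_if_cols[OF mat_adjoint_carrier[OF C] mult_carrier_mat[OF H Ci]])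
      fix x assume "x \<in> set (cols (H * Qs ! i))"
      then obtain y where y: "y \<in> set (cols (Qs ! i))" "x = H *\<^sub>v y"
        unfolding set_cols_mult[OF H Ci] by auto
      have "y \<in> block_krylov n H Z (Suc i)" using col_in_block_krylov[OF Qs _ y(1)] i len by simp
      then have "x \<in> block_krylov n H Z (Suc (Suc i))"
        unfolding y(2) by (rule mult_block_krylov[OF H Z])
      then show "mat_adjoint (Qs ! q) *\<^sub>v x = 0\<^sub>v ?m"
        using mat_adjoint_mult_krylov_zero[OF Qs, of x "Suc (Suc i)" q] that len by simp
    qed simp
    then have "mat_adjoint (mat_adjoint (Qs ! q) * (H * Qs ! i)) = 0\<^sub>m ?r ?m" by simp
    moreover have "mat_adjoint (mat_adjoint (Qs ! q) * (H * Qs ! i)) = mat_adjoint (H * Qs ! i) * Qs ! q"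
      using mat_adjoint_mult[OF mat_adjoint_carrier[OF C] mult_carrier_mat[OF H Ci], of q] by simp
    moreover have "mat_adjoint (H * Qs ! i) = mat_adjoint (Qs ! i) * H"
      using mat_adjoint_mult[OF H Ci] herm by simp
    moreover have "mat_adjoint (Qs ! i) * H * Qs ! q = X"
      unfolding X_def using assoc_mult_mat[OF aCi H C] by simp
    ultimately show ?thesis by simp
  qed
  have W: "lanczos_residual H Qs = (let W = H * Qs ! q - p q in if q = 0 then W else W - p (q - 1))"
    unfolding p_def by (rule lanczos_residual_eq[OF o H len])
  have X0: "X - X = 0\<^sub>m ?r ?m" "X - 0\<^sub>m ?r ?m = X" "0\<^sub>m ?r ?m - 0\<^sub>m ?r ?m = (0\<^sub>m ?r ?m :: complex mat)"
    using X by auto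
  show ?thesis
  proof (cases "q = 0")
    case True
    then show ?thesis unfolding W Let_def
      using mult_minus_distrib_mat[OF aCi HQ p(1)[of q]] p(2)[of q] i X0 by (simp add: X_def)
  next
    case False
    have "mat_adjoint (Qs ! i) * (H * Qs ! q - p q - p (q - 1))
        = X - mat_adjoint (Qs ! i) * p q - mat_adjoint (Qs ! i) * p (q - 1)"
      using mult_minus_distrib_mat[OF aCi HQ p(1)[of q]]
        mult_minus_distrib_mat[OF aCi minus_carrier_mat[OF p(1)[of q]] p(1)[of "q - 1"]]
      by (simp add: X_def)
    also have "\<dots> = 0\<^sub>m ?r ?m"
    proof -
      consider "i = q" | "i = q - 1" "i \<noteq> q" | "Suc i < q" using i by linarith
      then show ?thesis
        using p(2)[of q] p(2)[of "q - 1"] False X0 far by cases auto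
    qed
    finally show ?thesis unfolding W Let_def using False by simp
  qed
qed

lemma krylov_blocks_start:
  assumes Z: "Z \<in> carrier_mat n m" and H: "H \<in> carrier_mat n n" and Q: "orthonormal_col_basis n Z Q"
  shows "krylov_blocks H Z [Q]"
proof -
  have c: "Q \<in> carrier_mat n (dim_col Q)" "mat_adjoint Q * Q = 1\<^sub>m (dim_col Q)"
    "col_space Q = col_space Z" using Q unfolding orthonormal_col_basis_def by auto
  have "block_span (take k [Q]) = block_krylov n H Z k" if "k \<le> 1" for k
  proof (cases "k = 0")
    case True
    then show ?thesis
      by (simp add: block_span_def block_krylov_eq_span[OF H Z] krylov_gens_def)
  next
    case False
    then have "k = Suc 0" using that by simp
    then show ?thesis
      using c(3) by (simp add: block_krylov_1[OF H Z] block_span_def col_space_def)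
  qed
  moreover have "orthonormal_blocks [Q]"
    unfolding orthonormal_blocks_def list.set
  proof (intro conjI)
    show "\<forall>R\<in>{Q}. R \<in> carrier_mat n (dim_col R)" using c(1) by blast
  qed (simp add: c(2))
  ultimately show ?thesis unfolding krylov_blocks_def by simp
qed

text \<open>The new block is orthogonal to the old ones because its columns are combinations of columns of
  the residual. Modulo the old blocks, the residual is \<open>H\<close> applied to the last one. The earlier blocks
  are mapped by \<open>H\<close> into the old span already, so the enlarged span is the next Krylov subspace.\<close>

lemma krylov_blocks_step:
  assumes Qs: "krylov_blocks H Z Qs" and H: "H \<in> carrier_mat n n" and herm: "mat_adjoint H = H"
    and Z: "Z \<in> carrier_mat n m" and Q: "orthonormal_col_basis n (lanczos_residual H Qs) Q"
  shows "krylov_blocks H Z (Qs @ [Q])"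
proof -
  have o: "orthonormal_blocks Qs" and "Qs \<noteq> []" using Qs by (auto simp: krylov_blocks_def)
  then obtain q where len: "length Qs = Suc q" by (cases Qs) auto
  let ?W = "lanczos_residual H Qs"
  have c: "Q \<in> carrier_mat n (dim_col Q)" "mat_adjoint Q * Q = 1\<^sub>m (dim_col Q)"
    "col_space Q = col_space ?W" using Q unfolding orthonormal_col_basis_def by auto
  have C: "Qs ! j \<in> carrier_mat n (dim_col (Qs ! j))" if "j \<le> q" for j
    using orthonormal_blocks_carrier[OF o] len that by simp
  have W: "?W \<in> carrier_mat n (dim_col (Qs ! q))" by (rule lanczos_residual_carrier[OF o H len])
  have orth: "mat_adjoint (Qs ! i) * Q = 0\<^sub>m (dim_col (Qs ! i)) (dim_col Q)" if i: "i \<le> q" for i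
  proof (rule mult_mat_zero_if_cols[OF mat_adjoint_carrier[OF C[OF i]] c(1)])
    fix x assume "x \<in> set (cols Q)"
    then have x: "x \<in> span (set (cols ?W))"
      using in_own_span[OF cols_carrier[OF c(1)]] c(3) unfolding col_space_def by auto
    show "mat_adjoint (Qs ! i) *\<^sub>v x = 0\<^sub>v (dim_col (Qs ! i))"
    proof (rule mult_mat_vec_span_zero[OF mat_adjoint_carrier[OF C[OF i]] cols_carrier[OF W] _ x])
      fix w assume "w \<in> set (cols ?W)"
      then obtain d where d: "d < dim_col (Qs ! q)" "w = col ?W d" using W by (auto simp: cols_def)
      have "mat_adjoint (Qs ! i) *\<^sub>v w = col (mat_adjoint (Qs ! i) * ?W) d"
        unfolding d(2) by (rule col_mult2[OF mat_adjoint_carrier[OF C[OF i]] W d(1), symmetric])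
      then show "mat_adjoint (Qs ! i) *\<^sub>v w = 0\<^sub>v (dim_col (Qs ! i))"
        using d by (simp add: mat_adjoint_mult_lanczos_residual[OF Qs H herm Z len i])
    qed
  qed
  have orth': "mat_adjoint Q * Qs ! i = 0\<^sub>m (dim_col Q) (dim_col (Qs ! i))" if i: "i \<le> q" for i
    using mat_adjoint_mult[OF mat_adjoint_carrier[OF C[OF i]] c(1)] orth[OF i] by simp
  have o': "orthonormal_blocks (Qs @ [Q])"
    unfolding orthonormal_blocks_def
  proof (intro conjI allI impI)
    show "\<forall>R\<in>set (Qs @ [Q]). R \<in> carrier_mat n (dim_col R)"
      using o c(1) unfolding orthonormal_blocks_def set_append list.set by blast
    fix i j assume "i < length (Qs @ [Q])" "j < length (Qs @ [Q])"
    then have "i \<le> Suc q" "j \<le> Suc q" using len by simp_all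
    then consider "i \<le> q" "j \<le> q" | "i \<le> q" "j = Suc q" | "i = Suc q" "j \<le> q" | "i = Suc q" "j = Suc q"
      unfolding le_Suc_eq by blast
    then show "mat_adjoint ((Qs @ [Q]) ! i) * (Qs @ [Q]) ! j =
        (if i = j then 1\<^sub>m (dim_col ((Qs @ [Q]) ! i))
         else 0\<^sub>m (dim_col ((Qs @ [Q]) ! i)) (dim_col ((Qs @ [Q]) ! j)))"
    proof cases
      case 1
      then show ?thesis using orthonormal_blocks_mult[OF o, of i j] len by (simp add: nth_append)
    next
      case 2
      then show ?thesis using orth len by (simp add: nth_append)
    next
      case 3
      then show ?thesis using orth' len by (simp add: nth_append)
    next
      case 4
      then show ?thesis using c(2) len by (simp add: nth_append)
    qed
  qed
  let ?T = "\<Union>R\<in>set (Qs @ [Q]). set (cols R)"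
  have T: "?T \<subseteq> carrier_vec n" using block_gens_carrier[OF o', of "length (Qs @ [Q])"] by simp
  have spanQs: "block_span Qs = block_krylov n H Z (Suc q)"
    using Qs len unfolding krylov_blocks_def by auto
  have sub: "block_span Qs \<subseteq> span ?T" "col_space Q \<subseteq> span ?T"
    unfolding block_span_def col_space_def by (intro span_is_monotone; auto)+
  have gens: "krylov_gens H Z k \<subseteq> carrier_vec n" for k by (rule krylov_gens_carrier[OF H Z])
  note eq_span = block_krylov_eq_span[OF H Z]
  have "block_span (Qs @ [Q]) = block_krylov n H Z (Suc (Suc q))"
  proof
    show "block_krylov n H Z (Suc (Suc q)) \<subseteq> block_span (Qs @ [Q])"
      unfolding block_span_def
    proof (rule block_krylov_Suc_least[OF H Z T])
      show "set (cols Z) \<subseteq> span ?T"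
        using cols_subset_col_space[OF Z] col_space_subset_block_krylov[OF H Z, of q]
          sub(1)[unfolded spanQs] by blast
      fix v assume "v \<in> block_krylov n H Z (Suc q)"
      then have v: "v \<in> span (\<Union>R\<in>set Qs. set (cols R))" using spanQs unfolding block_span_def by simp
      show "H *\<^sub>v v \<in> span ?T"
      proof (rule mult_mat_vec_span[OF H _ T _ v])
        show "(\<Union>R\<in>set Qs. set (cols R)) \<subseteq> carrier_vec n" using T by auto
        fix x assume "x \<in> (\<Union>R\<in>set Qs. set (cols R))"
        then obtain R where R: "R \<in> set Qs" "x \<in> set (cols R)" by blast
        obtain i where "i < length Qs" "R = Qs ! i" using R(1) by (metis in_set_conv_nth)
        then have i: "i \<le> q" "x \<in> set (cols (Qs ! i))" using R(2) len by simp_all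
        show "H *\<^sub>v x \<in> span ?T"
        proof (cases "i = q")
          case True
          then obtain d where d: "d < dim_col (Qs ! q)" "x = col (Qs ! q) d"
            using i by (auto simp: cols_def)
          obtain t where t: "t \<in> block_span Qs" "H *\<^sub>v x = col ?W d + t"
            using lanczos_residual_col[OF o H len d(1)] d(2) by metis
          have "col ?W d \<in> set (cols ?W)" using d(1) W by (auto simp: cols_def)
          then have "col ?W d \<in> span ?T"
            using cols_subset_col_space[OF W] sub(2)[unfolded c(3)] by blast
          then show ?thesis unfolding t(2) by (rule span_add1[OF T _ subsetD[OF sub(1) t(1)]])
        next
          case False
          have "x \<in> block_krylov n H Z (Suc i)" using col_in_block_krylov[OF Qs _ i(2)] i(1) len by simp
          then have "H *\<^sub>v x \<in> block_krylov n H Z (Suc (Suc i))" by (rule mult_block_krylov[OF H Z])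
          then have "H *\<^sub>v x \<in> block_krylov n H Z (Suc q)"
            using block_krylov_mono[OF H Z, of "Suc (Suc i)" "Suc q"] False i(1) by auto
          then show ?thesis using sub(1)[unfolded spanQs] by blast
        qed
      qed
    qed
    have "set (cols ?W) \<subseteq> span (krylov_gens H Z (Suc (Suc q)))"
    proof
      fix w assume "w \<in> set (cols ?W)"
      then obtain d where d: "d < dim_col (Qs ! q)" "w = col ?W d" using W by (auto simp: cols_def)
      obtain t where t: "t \<in> block_span Qs" "t \<in> carrier_vec n" "H *\<^sub>v col (Qs ! q) d = w + t"
        using lanczos_residual_col[OF o H len d(1)] d(2) by metis
      have "w \<in> carrier_vec n" using d W by auto
      then have w: "w = H *\<^sub>v col (Qs ! q) d - t" using t(2,3) by (intro eq_vecI) auto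
      have "col (Qs ! q) d \<in> block_krylov n H Z (Suc q)"
        using len d(1) by (intro col_in_block_krylov[OF Qs]) (simp, auto simp: cols_def)
      then have "H *\<^sub>v col (Qs ! q) d \<in> span (krylov_gens H Z (Suc (Suc q)))"
        unfolding eq_span[symmetric] by (rule mult_block_krylov[OF H Z])
      moreover have "t \<in> span (krylov_gens H Z (Suc (Suc q)))"
        using t(1)[unfolded spanQs] block_krylov_mono[OF H Z, of "Suc q" "Suc (Suc q)"]
        unfolding eq_span[symmetric] by auto
      ultimately show "w \<in> span (krylov_gens H Z (Suc (Suc q)))"
        unfolding w by (intro span_minus gens)
    qed
    then have "col_space Q \<subseteq> block_krylov n H Z (Suc (Suc q))"
      unfolding c(3) eq_span by (rule col_space_mono) (rule gens)
    moreover have "block_span Qs \<subseteq> block_krylov n H Z (Suc (Suc q))"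
      using spanQs block_krylov_mono[OF H Z, of "Suc q" "Suc (Suc q)"] by auto
    moreover have "(\<Union>R\<in>set Qs. set (cols R)) \<subseteq> block_span Qs" "set (cols Q) \<subseteq> col_space Q"
      unfolding block_span_def col_space_def using T by (intro in_own_span; auto)+
    ultimately have "?T \<subseteq> span (krylov_gens H Z (Suc (Suc q)))" unfolding eq_span by auto
    then show "block_span (Qs @ [Q]) \<subseteq> block_krylov n H Z (Suc (Suc q))"
      unfolding block_span_def eq_span by (rule span_subsetI[OF gens])
  qed
  moreover have "block_span (take k (Qs @ [Q])) = block_krylov n H Z k" if "k \<le> Suc q" for k
    using Qs len that unfolding krylov_blocks_def by simp
  ultimately have "block_span (take k (Qs @ [Q])) = block_krylov n H Z k"
    if "k \<le> length (Qs @ [Q])" for k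
    using that len by (cases "k = Suc (Suc q)") auto
  then show ?thesis unfolding krylov_blocks_def using o' by simp
qed

lemma block_lanczos_krylov_blocks:
  assumes run: "block_lanczos n H Z Qs" and H: "H \<in> carrier_mat n n" and herm: "mat_adjoint H = H"
    and Z: "Z \<in> carrier_mat n m"
  shows "krylov_blocks H Z Qs \<and> (\<forall>Q\<in>set Qs. dim_col Q \<le> m)"
  using run
proof (induction rule: block_lanczos.induct)
  case (start Q)
  then show ?case
    using krylov_blocks_start[OF Z H] orthonormal_col_basis_dim_col_le[OF _ Z] by simp
next
  case (step Qs W Q)
  have o: "orthonormal_blocks Qs" and "Qs \<noteq> []" using step.IH by (auto simp: krylov_blocks_def)
  then obtain q where len: "length Qs = Suc q" by (cases Qs) auto
  have "Qs ! q \<in> set Qs" using len by simp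
  then have "dim_col (Qs ! q) \<le> m" using step.IH by blast
  moreover have "dim_col Q \<le> dim_col (Qs ! q)"
    using orthonormal_col_basis_dim_col_le[OF _ lanczos_residual_carrier[OF o H len]] step.hyps by simp
  ultimately have "dim_col Q \<le> m" by simp
  moreover have "krylov_blocks H Z (Qs @ [Q])"
    using step.IH step.hyps by (intro krylov_blocks_step[OF _ H herm Z]) auto
  ultimately show ?case using step.IH by simp
qed

section \<open>Unitarity and block tridiagonal form\<close>

lemma cols_hconcat_blocks:
  assumes "orthonormal_blocks Qs"
  shows "cols (hconcat n Qs) = concat (map cols Qs)"
proof (rule cols_hconcat)
  show "dim_row M = n" if "M \<in> set Qs" for M
    using assms that unfolding orthonormal_blocks_def by blast
qed

text \<open>A column index amounts to a block number together with an offset in that block. Distinct indices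
  have distinct pairs, so the blockwise relations yield the entries of the identity matrix.\<close>

lemma hconcat_blocks_orthonormal:
  assumes o: "orthonormal_blocks Qs"
  shows "mat_adjoint (hconcat n Qs) * hconcat n Qs = 1\<^sub>m (sum_list (map dim_col Qs))"
proof (rule eq_matI)
  let ?N = "sum_list (map dim_col Qs)" and ?Q = "hconcat n Qs"
  have Q: "?Q \<in> carrier_mat n ?N" by (rule hconcat_carrier)
  fix i j assume "i < dim_row (1\<^sub>m ?N)" "j < dim_col (1\<^sub>m ?N)"
  then have ij: "i < ?N" "j < ?N" by simp_all
  have block: "\<exists>k a. k < length Qs \<and> a < dim_col (Qs ! k) \<and> col ?Q i = col (Qs ! k) a \<and>
      i = sum_list (map dim_col (take k Qs)) + a" if "i < ?N" for i
  proof -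
    have "i < length (concat (map cols Qs))" using that by (simp add: length_concat comp_def)
    from nth_concat_exists[OF this] obtain k a where "k < length Qs" "a < dim_col (Qs ! k)"
      "concat (map cols Qs) ! i = cols (Qs ! k) ! a"
      "i = sum_list (map dim_col (take k Qs)) + a"
      by (auto simp: take_map comp_def)
    moreover have "col ?Q i = concat (map cols Qs) ! i"
      using that Q cols_hconcat_blocks[OF o] by (metis carrier_matD(2) cols_nth)
    ultimately show ?thesis by (metis cols_nth)
  qed
  have entry: "(mat_adjoint X * Y) $$ (a, b) = conjugate (col X a) \<bullet> col Y b"
    if "a < dim_col X" "b < dim_col Y" for X Y :: "complex mat" and a b
    using that by (simp add: mat_adjoint_def)
  obtain k a where k: "k < length Qs" "a < dim_col (Qs ! k)" "col ?Q i = col (Qs ! k) a"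
    "i = sum_list (map dim_col (take k Qs)) + a" using block[OF ij(1)] by blast
  have lhs: "(mat_adjoint ?Q * ?Q) $$ (i, j) = conjugate (col ?Q i) \<bullet> col ?Q j"
    using ij Q by (intro entry) auto
  show "(mat_adjoint ?Q * ?Q) $$ (i, j) = 1\<^sub>m ?N $$ (i, j)"
  proof (cases "i = j")
    case True
    have "conjugate (col (Qs ! k) a) \<bullet> col (Qs ! k) a = 1"
      using entry[of a "Qs ! k" a "Qs ! k"] orthonormal_blocks_mult[OF o k(1) k(1)] k(2) by simp
    then show ?thesis using lhs True ij k(3) by simp
  next
    case False
    obtain l b where l: "l < length Qs" "b < dim_col (Qs ! l)" "col ?Q j = col (Qs ! l) b"
      "j = sum_list (map dim_col (take l Qs)) + b" using block[OF ij(2)] by blast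
    have "k \<noteq> l \<or> a \<noteq> b" using False k(4) l(4) by auto
    then have "conjugate (col (Qs ! k) a) \<bullet> col (Qs ! l) b = 0"
      using entry[of a "Qs ! k" b "Qs ! l"] orthonormal_blocks_mult[OF o k(1) l(1)] k(2) l(2)
      by (auto split: if_splits)
    then show ?thesis using lhs False ij k(3) l(3) by simp
  qed
qed (use hconcat_carrier[of n Qs] in auto)

text \<open>The loop ends as soon as there are at least \<open>n\<close> columns. More than \<open>n\<close> orthonormal columns do not
  exist, so the matrix is square and its left inverse is two-sided.\<close>

lemma hconcat_blocks_unitary:
  assumes o: "orthonormal_blocks Qs" and total: "n \<le> sum_list (map dim_col Qs)"
  shows "sum_list (map dim_col Qs) = n" "unitary_mat n (hconcat n Qs)"
proof -
  let ?Q = "hconcat n Qs"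
  note Q = hconcat_carrier[of n Qs] and QQ = hconcat_blocks_orthonormal[OF o]
  show N: "sum_list (map dim_col Qs) = n"
    using dim_col_le_if_left_inverse[OF Q mat_adjoint_carrier[OF Q] QQ] total by simp
  have Q': "?Q \<in> carrier_mat n n" and QQ': "mat_adjoint ?Q * ?Q = 1\<^sub>m n" using Q QQ N by simp_all
  then show "unitary_mat n ?Q"
    unfolding unitary_mat_def
    using mat_mult_left_right_inverse[OF mat_adjoint_carrier[OF Q'] Q' QQ'] by blast
qed

lemma col_hconcat_block:
  assumes o: "orthonormal_blocks Qs" and k: "k < length Qs" and i: "i \<in> block_indices (map dim_col Qs) k"
  obtains a where "a < dim_col (Qs ! k)" "col (hconcat n Qs) i = col (Qs ! k) a"
    "i < sum_list (map dim_col Qs)"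
proof -
  let ?s = "sum_list (map dim_col (take k Qs))"
  have b: "?s \<le> i" "i < ?s + dim_col (Qs ! k)"
    using i k unfolding block_indices_def by (auto simp: take_map take_Suc_conv_app_nth)
  have split: "sum_list (map dim_col Qs) = ?s + dim_col (Qs ! k) + sum_list (map dim_col (drop (Suc k) Qs))"
    using arg_cong[OF id_take_nth_drop[OF k], of "\<lambda>xs. sum_list (map dim_col xs)"] by simp
  have "concat (map cols Qs) ! (?s + (i - ?s)) = cols (Qs ! k) ! (i - ?s)"
    using nth_concat_offset[of k "map cols Qs" "i - ?s"] k b by (simp add: take_map comp_def)
  moreover have "i < sum_list (map dim_col Qs)" using b split by simp
  moreover have "cols (hconcat n Qs) ! i = col (hconcat n Qs) i"
    using \<open>i < sum_list (map dim_col Qs)\<close> hconcat_carrier[of n Qs] by simp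
  ultimately show ?thesis
    using b cols_hconcat_blocks[OF o] by (intro that[of "i - ?s"]) simp_all
qed

text \<open>Column \<open>j\<close> belongs to \<open>K\<^sub>l\<^sub>+\<^sub>1\<close>, so \<open>M\<close> maps it into \<open>K\<^sub>l\<^sub>+\<^sub>2\<close>, which is orthogonal to the block
  \<open>k\<close> because \<open>l + 2 \<le> k\<close>.\<close>

lemma krylov_blocks_lower_zero:
  assumes Qs: "krylov_blocks H Z Qs" and M: "M \<in> carrier_mat n n"
    and mult: "\<And>j v. v \<in> block_krylov n H Z j \<Longrightarrow> M *\<^sub>v v \<in> block_krylov n H Z (Suc j)"
    and kl: "l + 1 < k" "k < length Qs"
    and i: "i \<in> block_indices (map dim_col Qs) k" and j: "j \<in> block_indices (map dim_col Qs) l"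
  shows "(mat_adjoint (hconcat n Qs) * M * hconcat n Qs) $$ (i, j) = 0"
proof -
  have o: "orthonormal_blocks Qs" using Qs by (simp add: krylov_blocks_def)
  let ?Q = "hconcat n Qs"
  note Q = hconcat_carrier[of n Qs] and aQ = mat_adjoint_carrier[OF hconcat_carrier[of n Qs]]
  note C = orthonormal_blocks_carrier[OF o]
  obtain a where a: "a < dim_col (Qs ! k)" "col ?Q i = col (Qs ! k) a" "i < sum_list (map dim_col Qs)"
    using col_hconcat_block[OF o kl(2) i] .
  have l: "l < length Qs" using kl by simp
  obtain b where b: "b < dim_col (Qs ! l)" "col ?Q j = col (Qs ! l) b" "j < sum_list (map dim_col Qs)"
    using col_hconcat_block[OF o l j] .
  have "col (Qs ! l) b \<in> set (cols (Qs ! l))" using b(1) by (auto simp: cols_def)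
  then have "M *\<^sub>v col (Qs ! l) b \<in> block_krylov n H Z (Suc (Suc l))"
    by (intro mult col_in_block_krylov[OF Qs l])
  then have zero: "mat_adjoint (Qs ! k) *\<^sub>v (M *\<^sub>v col (Qs ! l) b) = 0\<^sub>v (dim_col (Qs ! k))"
    using kl by (intro mat_adjoint_mult_krylov_zero[OF Qs]) auto
  have row: "row (mat_adjoint X) c = conjugate (col X c)" if "c < dim_col X" for X :: "complex mat" and c
    using that by (simp add: mat_adjoint_def)
  have "(mat_adjoint ?Q * M * ?Q) $$ (i, j) = (mat_adjoint ?Q * (M * ?Q)) $$ (i, j)"
    using assoc_mult_mat[OF aQ M Q] by simp
  also have "\<dots> = row (mat_adjoint ?Q) i \<bullet> col (M * ?Q) j"
    using a(3) b(3) Q M by (intro index_mult_mat(1)) auto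
  also have "row (mat_adjoint ?Q) i = row (mat_adjoint (Qs ! k)) a"
    using row[of i ?Q] row[OF a(1)] a Q by simp
  also have "col (M * ?Q) j = M *\<^sub>v col (Qs ! l) b"
    using col_mult2[OF M Q b(3)] b(2) by simp
  also have "row (mat_adjoint (Qs ! k)) a \<bullet> (M *\<^sub>v col (Qs ! l) b)
      = (mat_adjoint (Qs ! k) *\<^sub>v (M *\<^sub>v col (Qs ! l) b)) $ a"
    using a(1) by (intro index_mult_mat_vec[symmetric]) simp
  also have "\<dots> = 0" using zero a(1) by simp
  finally show ?thesis .
qed

lemma krylov_blocks_block_tridiagonal:
  assumes Qs: "krylov_blocks H Z Qs" and M: "M \<in> carrier_mat n n"
    and mult: "\<And>j v. v \<in> block_krylov n H Z j \<Longrightarrow> M *\<^sub>v v \<in> block_krylov n H Z (Suc j)"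
    and mult_adj: "\<And>j v. v \<in> block_krylov n H Z j \<Longrightarrow> mat_adjoint M *\<^sub>v v \<in> block_krylov n H Z (Suc j)"
  shows "block_tridiagonal (map dim_col Qs) (mat_adjoint (hconcat n Qs) * M * hconcat n Qs)"
  unfolding block_tridiagonal_def
proof (intro conjI allI impI ballI)
  have o: "orthonormal_blocks Qs" using Qs by (simp add: krylov_blocks_def)
  let ?Q = "hconcat n Qs" and ?N = "sum_list (map dim_col Qs)"
  note Q = hconcat_carrier[of n Qs] and aQ = mat_adjoint_carrier[OF hconcat_carrier[of n Qs]]
    and aM = mat_adjoint_carrier[OF M]
  show "mat_adjoint ?Q * M * ?Q \<in> carrier_mat ?N ?N"
    by (rule mult_carrier_mat[OF mult_carrier_mat[OF aQ M] Q])
  fix k l i j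
  assume k: "k < length (map dim_col Qs)" and l: "l < length (map dim_col Qs)"
    and kl: "k + 1 < l \<or> l + 1 < k"
    and i: "i \<in> block_indices (map dim_col Qs) k" and j: "j \<in> block_indices (map dim_col Qs) l"
  from kl show "(mat_adjoint ?Q * M * ?Q) $$ (i, j) = 0"
  proof
    assume "l + 1 < k"
    then show ?thesis using krylov_blocks_lower_zero[OF Qs M mult _ _ i j] k by simp
  next
    \<comment> \<open>Above the diagonal: pass to the adjoint matrix, where the entry is below the diagonal.\<close>
    assume kl: "k + 1 < l"
    have ij: "i < ?N" "j < ?N"
      using col_hconcat_block[OF o _ i] col_hconcat_block[OF o _ j] k l by (metis length_map)+
    have "mat_adjoint (mat_adjoint ?Q * M * ?Q) = mat_adjoint ?Q * (mat_adjoint M * ?Q)"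
      using mat_adjoint_mult[OF mult_carrier_mat[OF aQ M] Q] mat_adjoint_mult[OF aQ M] by simp
    also have "\<dots> = mat_adjoint ?Q * mat_adjoint M * ?Q"
      by (rule assoc_mult_mat[OF aQ aM Q, symmetric])
    finally have "mat_adjoint (mat_adjoint ?Q * M * ?Q) $$ (j, i) = 0"
      using krylov_blocks_lower_zero[OF Qs aM mult_adj kl _ j i] l by simp
    moreover have "mat_adjoint (mat_adjoint ?Q * M * ?Q) $$ (j, i)
        = conjugate ((mat_adjoint ?Q * M * ?Q) $$ (i, j))"
      using ij Q by (intro mat_adjoint_index) auto
    ultimately show ?thesis by simp
  qed
qed

section \<open>Hermitian and antihermitian parts\<close>

context
  fixes A :: "complex mat"
  assumes A: "A \<in> carrier_mat n n"
begin

lemma parts_carrier: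
  "hermitian_part A \<in> carrier_mat n n" "antihermitian_part A \<in> carrier_mat n n"
  using A mat_adjoint_carrier[OF A] unfolding hermitian_part_def antihermitian_part_def by auto

lemma Delta_carrier: "Delta A \<in> carrier_mat n n"
  using A mat_adjoint_carrier[OF A] unfolding Delta_def by auto

lemma mat_adjoint_parts:
  "mat_adjoint (hermitian_part A) = hermitian_part A"
  "mat_adjoint (antihermitian_part A) = (-1) \<cdot>\<^sub>m antihermitian_part A"
proof -
  note aA = mat_adjoint_carrier[OF A]
  show "mat_adjoint (hermitian_part A) = hermitian_part A"
    unfolding hermitian_part_def mat_adjoint_smult mat_adjoint_add[OF A aA]
    using A by (intro eq_matI) (auto simp: mat_adjoint_index)
  show "mat_adjoint (antihermitian_part A) = (-1) \<cdot>\<^sub>m antihermitian_part A"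
    unfolding antihermitian_part_def mat_adjoint_smult mat_adjoint_minus[OF A aA]
    using A by (intro eq_matI) (auto simp: mat_adjoint_index)
qed

lemma mat_adjoint_Delta: "mat_adjoint (Delta A) = Delta A"
proof -
  note aA = mat_adjoint_carrier[OF A]
  show ?thesis
    unfolding Delta_def mat_adjoint_minus[OF mult_carrier_mat[OF aA A] mult_carrier_mat[OF A aA]]
      mat_adjoint_mult[OF aA A] mat_adjoint_mult[OF A aA] mat_adjoint_mat_adjoint ..
qed

lemma mult_parts:
  assumes x: "x \<in> carrier_vec n"
  shows "hermitian_part A *\<^sub>v x = (1/2) \<cdot>\<^sub>v (A *\<^sub>v x + mat_adjoint A *\<^sub>v x)"
    and "antihermitian_part A *\<^sub>v x = (1/2) \<cdot>\<^sub>v (A *\<^sub>v x - mat_adjoint A *\<^sub>v x)"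
    and "Delta A *\<^sub>v x = mat_adjoint A *\<^sub>v (A *\<^sub>v x) - A *\<^sub>v (mat_adjoint A *\<^sub>v x)"
proof -
  note aA = mat_adjoint_carrier[OF A]
  show "hermitian_part A *\<^sub>v x = (1/2) \<cdot>\<^sub>v (A *\<^sub>v x + mat_adjoint A *\<^sub>v x)"
    unfolding hermitian_part_def smult_mat_mult_vec[OF add_carrier_mat[OF aA] x]
      add_mult_distrib_mat_vec[OF A aA x] ..
  show "antihermitian_part A *\<^sub>v x = (1/2) \<cdot>\<^sub>v (A *\<^sub>v x - mat_adjoint A *\<^sub>v x)"
    unfolding antihermitian_part_def smult_mat_mult_vec[OF minus_carrier_mat[OF aA] x]
      minus_mult_distrib_mat_vec[OF A aA x] ..
  show "Delta A *\<^sub>v x = mat_adjoint A *\<^sub>v (A *\<^sub>v x) - A *\<^sub>v (mat_adjoint A *\<^sub>v x)"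
    unfolding Delta_def
      minus_mult_distrib_mat_vec[OF mult_carrier_mat[OF aA A] mult_carrier_mat[OF A aA] x]
      assoc_mult_mat_vec[OF aA A x] assoc_mult_mat_vec[OF A aA x] ..
qed

lemma parts_recombine:
  assumes x: "x \<in> carrier_vec n"
  shows "A *\<^sub>v x = hermitian_part A *\<^sub>v x + antihermitian_part A *\<^sub>v x"
    and "mat_adjoint A *\<^sub>v x = hermitian_part A *\<^sub>v x - antihermitian_part A *\<^sub>v x"
    and "antihermitian_part A *\<^sub>v x = A *\<^sub>v x - hermitian_part A *\<^sub>v x"
    and "antihermitian_part A *\<^sub>v x = hermitian_part A *\<^sub>v x - mat_adjoint A *\<^sub>v x"
proof -
  have halves: "a = (1/2) \<cdot>\<^sub>v (a + b) + (1/2) \<cdot>\<^sub>v (a - b)" "b = (1/2) \<cdot>\<^sub>v (a + b) - (1/2) \<cdot>\<^sub>v (a - b)"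
    "(1/2) \<cdot>\<^sub>v (a - b) = a - (1/2) \<cdot>\<^sub>v (a + b)" "(1/2) \<cdot>\<^sub>v (a - b) = (1/2) \<cdot>\<^sub>v (a + b) - b"
    if "a \<in> carrier_vec n" "b \<in> carrier_vec n" for a b :: "complex vec"
    using that by (intro eq_vecI; auto simp: field_simps)+
  note c = mult_mat_vec_carrier[OF A x] mult_mat_vec_carrier[OF mat_adjoint_carrier[OF A] x]
  show "A *\<^sub>v x = hermitian_part A *\<^sub>v x + antihermitian_part A *\<^sub>v x"
    unfolding mult_parts[OF x] by (rule halves(1)[OF c])
  show "mat_adjoint A *\<^sub>v x = hermitian_part A *\<^sub>v x - antihermitian_part A *\<^sub>v x"
    unfolding mult_parts[OF x] by (rule halves(2)[OF c])
  show "antihermitian_part A *\<^sub>v x = A *\<^sub>v x - hermitian_part A *\<^sub>v x"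
    unfolding mult_parts[OF x] by (rule halves(3)[OF c])
  show "antihermitian_part A *\<^sub>v x = hermitian_part A *\<^sub>v x - mat_adjoint A *\<^sub>v x"
    unfolding mult_parts[OF x] by (rule halves(4)[OF c])
qed

text \<open>With \<open>H = (A + B) / 2\<close> and \<open>S = (A - B) / 2\<close>, where \<open>B = A\<^sup>H\<close>, the products \<open>A A\<close> and \<open>B B\<close> cancel in
  \<open>H S - S H\<close> and \<open>(B A - A B) / 2\<close> remains.\<close>

lemma commutator_parts:
  assumes x: "x \<in> carrier_vec n"
  shows "hermitian_part A *\<^sub>v (antihermitian_part A *\<^sub>v x)
       - antihermitian_part A *\<^sub>v (hermitian_part A *\<^sub>v x) = (1/2) \<cdot>\<^sub>v (Delta A *\<^sub>v x)"
proof -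
  let ?B = "mat_adjoint A"
  have B: "?B \<in> carrier_mat n n" using mat_adjoint_carrier[OF A] .
  have Ax: "A *\<^sub>v x \<in> carrier_vec n" and Bx: "?B *\<^sub>v x \<in> carrier_vec n"
    using mult_mat_vec_carrier[OF A x] mult_mat_vec_carrier[OF B x] by simp_all
  have c: "A *\<^sub>v (A *\<^sub>v x) \<in> carrier_vec n" "A *\<^sub>v (?B *\<^sub>v x) \<in> carrier_vec n"
    "?B *\<^sub>v (A *\<^sub>v x) \<in> carrier_vec n" "?B *\<^sub>v (?B *\<^sub>v x) \<in> carrier_vec n"
    by (rule mult_mat_vec_carrier[OF A Ax] mult_mat_vec_carrier[OF A Bx]
        mult_mat_vec_carrier[OF B Ax] mult_mat_vec_carrier[OF B Bx])+
  have half: "M *\<^sub>v ((1/2) \<cdot>\<^sub>v (A *\<^sub>v x + ?B *\<^sub>v x)) = (1/2) \<cdot>\<^sub>v (M *\<^sub>v (A *\<^sub>v x) + M *\<^sub>v (?B *\<^sub>v x))"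
    "M *\<^sub>v ((1/2) \<cdot>\<^sub>v (A *\<^sub>v x - ?B *\<^sub>v x)) = (1/2) \<cdot>\<^sub>v (M *\<^sub>v (A *\<^sub>v x) - M *\<^sub>v (?B *\<^sub>v x))"
    if M: "M \<in> carrier_mat n n" for M :: "complex mat"
    using mult_mat_vec[OF M add_carrier_vec[OF Ax Bx]] mult_mat_vec[OF M minus_carrier_vec[OF Ax Bx]]
      mult_add_distrib_mat_vec[OF M Ax Bx] mult_minus_distrib_mat_vec[OF M Ax Bx] by auto
  have Hx: "hermitian_part A *\<^sub>v x \<in> carrier_vec n" "antihermitian_part A *\<^sub>v x \<in> carrier_vec n"
    by (rule mult_mat_vec_carrier[OF parts_carrier(1) x] mult_mat_vec_carrier[OF parts_carrier(2) x])+
  have cancel: "(1/2) \<cdot>\<^sub>v ((1/2) \<cdot>\<^sub>v (aa - ab) + (1/2) \<cdot>\<^sub>v (ba - bb))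
      - (1/2) \<cdot>\<^sub>v ((1/2) \<cdot>\<^sub>v (aa + ab) - (1/2) \<cdot>\<^sub>v (ba + bb)) = (1/2) \<cdot>\<^sub>v (ba - ab)"
    if "aa \<in> carrier_vec n" "ab \<in> carrier_vec n" "ba \<in> carrier_vec n" "bb \<in> carrier_vec n"
    for aa ab ba bb :: "complex vec"
    using that by (intro eq_vecI) (auto simp: field_simps)
  \<comment> \<open>The outer \<open>H\<close> and \<open>S\<close> have to be expanded first: their arguments contain the inner ones.\<close>
  show ?thesis
    unfolding mult_parts(1)[OF Hx(2)] mult_parts(2)[OF Hx(1)]
    unfolding mult_parts[OF x] half[OF A] half[OF B]
    by (rule cancel[OF c])
qed

end

section \<open>The range of the commutator\<close>

lemma col_space_hconcat_pair:
  assumes X: "X \<in> carrier_mat n a" and Y: "Y \<in> carrier_mat n b"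
  shows "hconcat n [X, Y] \<in> carrier_mat n (a + b)"
    and "set (cols (hconcat n [X, Y])) = set (cols X) \<union> set (cols Y)"
    and "col_space (hconcat n [X, Y]) = span (set (cols X) \<union> set (cols Y))"
proof -
  show "hconcat n [X, Y] \<in> carrier_mat n (a + b)" using hconcat_carrier[of n "[X, Y]"] X Y by simp
  show s: "set (cols (hconcat n [X, Y])) = set (cols X) \<union> set (cols Y)"
    using X Y by (subst cols_hconcat) auto
  show "col_space (hconcat n [X, Y]) = span (set (cols X) \<union> set (cols Y))"
    unfolding col_space_def s ..
qed

text \<open>The \<open>a + b\<close> columns of \<open>X\<close> and \<open>Y\<close> cannot span more than \<open>a + b\<close> dimensions, and this many
  are already used up by \<open>D\<close>.\<close>

lemma col_space_eq_hconcat_if_range_subset: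
  assumes D: "D \<in> carrier_mat n k" and X: "X \<in> carrier_mat n a" and Y: "Y \<in> carrier_mat n b"
    and range: "\<And>x. x \<in> carrier_vec k \<Longrightarrow> D *\<^sub>v x \<in> span (set (cols X) \<union> set (cols Y))"
    and rank: "rank D = a + b"
  shows "col_space D = col_space (hconcat n [X, Y])"
proof (rule col_space_eq_if_rank_le[OF D col_space_hconcat_pair(1)[OF X Y]])
  show "col_space D \<subseteq> col_space (hconcat n [X, Y])"
    using range D unfolding col_space_eq[OF D] col_space_hconcat_pair(3)[OF X Y] by auto
  show "rank (hconcat n [X, Y]) \<le> rank D"
    using rank_le_nc[OF col_space_hconcat_pair(1)[OF X Y]] rank by simp
qed

text \<open>\<open>U (W\<^sup>H A x)\<close> is a combination of columns of \<open>U\<close>, and \<open>A U (W\<^sup>H x)\<close> one of columns of \<open>A U\<close>.\<close>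

lemma commutator_range:
  assumes A: "A \<in> carrier_mat n n" and U: "U \<in> carrier_mat n k" and W: "W \<in> carrier_mat n k"
    and x: "x \<in> carrier_vec n"
  shows "(U * mat_adjoint W * A - A * (U * mat_adjoint W)) *\<^sub>v x
    \<in> span (set (cols U) \<union> set (cols (A * U)))"
proof -
  note aV = mat_adjoint_carrier[OF W] and AU = mult_carrier_mat[OF A U]
  note C = mult_carrier_mat[OF U aV]
  let ?G = "set (cols U) \<union> set (cols (A * U))"
  have G: "?G \<subseteq> carrier_vec n" using cols_carrier[OF U] cols_carrier[OF AU] by simp
  have Ax: "A *\<^sub>v x \<in> carrier_vec n" using A x by auto
  define p where "p = mat_adjoint W *\<^sub>v (A *\<^sub>v x)"
  define q where "q = mat_adjoint W *\<^sub>v x"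
  have pq: "p \<in> carrier_vec k" "q \<in> carrier_vec k"
    unfolding p_def q_def using mult_mat_vec_carrier[OF aV] Ax x by auto
  have "(U * mat_adjoint W * A - A * (U * mat_adjoint W)) *\<^sub>v x
      = (U * mat_adjoint W * A) *\<^sub>v x - (A * (U * mat_adjoint W)) *\<^sub>v x"
    by (rule minus_mult_distrib_mat_vec[OF mult_carrier_mat[OF C A] mult_carrier_mat[OF A C] x])
  also have "(U * mat_adjoint W * A) *\<^sub>v x = U *\<^sub>v p"
    unfolding p_def assoc_mult_mat_vec[OF C A x] assoc_mult_mat_vec[OF U aV Ax] ..
  also have "(A * (U * mat_adjoint W)) *\<^sub>v x = (A * U) *\<^sub>v q"
    unfolding q_def assoc_mult_mat[OF A U aV, symmetric] assoc_mult_mat_vec[OF AU aV x] ..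
  finally have eq: "(U * mat_adjoint W * A - A * (U * mat_adjoint W)) *\<^sub>v x
      = U *\<^sub>v p - (A * U) *\<^sub>v q" .
  have "col_space U \<subseteq> span ?G" "col_space (A * U) \<subseteq> span ?G"
    unfolding col_space_def by (intro span_is_monotone; simp)+
  then show ?thesis
    unfolding eq using mult_mat_vec_in_col_space[OF U pq(1)] mult_mat_vec_in_col_space[OF AU pq(2)]
    by (intro span_minus[OF G]) auto
qed

context
  fixes A U W :: "complex mat" and k :: nat
  assumes A: "A \<in> carrier_mat n n" and U: "U \<in> carrier_mat n k" and W: "W \<in> carrier_mat n k"
    and commutator: "Delta A = U * mat_adjoint W * A - A * (U * mat_adjoint W)"
    and rank_UW: "rank (hconcat n [U, W]) = k + k"
    and rank_Delta: "rank (Delta A) = k + k"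
begin

text \<open>The rank of \<open>\<Delta>(A)\<close> is the number of columns of each of the three pairs, so one inclusion is enough
  for each equality. The second equality is the first one for the adjoint equation
  \<open>\<Delta>(A) = \<Delta>(A)\<^sup>H = -(C\<^sup>H A\<^sup>H - A\<^sup>H C\<^sup>H)\<close>, where \<open>C\<^sup>H = W U\<^sup>H\<close>. Together the two put the columns of \<open>U\<close>
  and of \<open>W\<close> into the range.\<close>

lemma col_space_Delta:
  "col_space (Delta A) = col_space (hconcat n [U, A * U])"
  "col_space (Delta A) = col_space (hconcat n [W, mat_adjoint A * W])"
  "col_space (Delta A) = col_space (hconcat n [U, W])"
proof -
  note aA = mat_adjoint_carrier[OF A] and aU = mat_adjoint_carrier[OF U] and aV = mat_adjoint_carrier[OF W]
  note D = Delta_carrier[OF A]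
  show eqU: "col_space (Delta A) = col_space (hconcat n [U, A * U])"
    using commutator_range[OF A U W] rank_Delta unfolding commutator[symmetric]
    by (intro col_space_eq_hconcat_if_range_subset[OF D U mult_carrier_mat[OF A U]]) auto
  have neg: "Delta A = (-1) \<cdot>\<^sub>m (W * mat_adjoint U * mat_adjoint A - mat_adjoint A * (W * mat_adjoint U))"
  proof -
    note C = mult_carrier_mat[OF U aV] and C' = mult_carrier_mat[OF W aU]
    have "Delta A = mat_adjoint (U * mat_adjoint W * A - A * (U * mat_adjoint W))"
      using mat_adjoint_Delta[OF A] commutator by simp
    also have "\<dots> = mat_adjoint A * (W * mat_adjoint U) - W * mat_adjoint U * mat_adjoint A"
      using mat_adjoint_minus[OF mult_carrier_mat[OF C A] mult_carrier_mat[OF A C]]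
        mat_adjoint_mult[OF C A] mat_adjoint_mult[OF A C] mat_adjoint_mult[OF U aV] by simp
    also have "\<dots> = (-1) \<cdot>\<^sub>m (W * mat_adjoint U * mat_adjoint A - mat_adjoint A * (W * mat_adjoint U))"
    proof -
      have "X - Y = (-1) \<cdot>\<^sub>m (Y - X)" if "X \<in> carrier_mat n n" "Y \<in> carrier_mat n n"
        for X Y :: "complex mat" using that by (intro eq_matI) auto
      from this[OF mult_carrier_mat[OF aA C'] mult_carrier_mat[OF C' aA]] show ?thesis .
    qed
    finally show ?thesis .
  qed
  show eqV: "col_space (Delta A) = col_space (hconcat n [W, mat_adjoint A * W])"
  proof (rule col_space_eq_hconcat_if_range_subset[OF D W mult_carrier_mat[OF aA W] _ rank_Delta])
    fix x :: "complex vec" assume x: "x \<in> carrier_vec n"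
    let ?E = "W * mat_adjoint U * mat_adjoint A - mat_adjoint A * (W * mat_adjoint U)"
    have E: "?E \<in> carrier_mat n n"
      by (intro minus_carrier_mat mult_carrier_mat[OF aA] mult_carrier_mat[OF W aU])
    have "Delta A *\<^sub>v x = (-1) \<cdot>\<^sub>v (?E *\<^sub>v x)"
      unfolding neg by (rule smult_mat_mult_vec[OF E x])
    moreover have "set (cols W) \<union> set (cols (mat_adjoint A * W)) \<subseteq> carrier_vec n"
      using cols_carrier[OF W] cols_carrier[OF mult_carrier_mat[OF aA W]] by simp
    ultimately show "Delta A *\<^sub>v x \<in> span (set (cols W) \<union> set (cols (mat_adjoint A * W)))"
      using smult_in_span[OF _ commutator_range[OF aA W U x], of "-1"] by simp
  qed
  have "set (cols U) \<subseteq> col_space (Delta A)" "set (cols W) \<subseteq> col_space (Delta A)"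
    using cols_subset_col_space[OF col_space_hconcat_pair(1)[OF U mult_carrier_mat[OF A U]]]
      cols_subset_col_space[OF col_space_hconcat_pair(1)[OF W mult_carrier_mat[OF aA W]]]
    unfolding eqU[symmetric] eqV[symmetric] col_space_hconcat_pair(2)[OF U mult_carrier_mat[OF A U]]
      col_space_hconcat_pair(2)[OF W mult_carrier_mat[OF aA W]] by auto
  then have "col_space (hconcat n [U, W]) \<subseteq> col_space (Delta A)"
    unfolding col_space_def[of "Delta A"]
    by (intro col_space_mono cols_carrier[OF D]) (simp add: col_space_hconcat_pair(2)[OF U W])
  then show "col_space (Delta A) = col_space (hconcat n [U, W])"
    using rank_UW rank_Delta
    by (intro col_space_eq_if_rank_le[OF col_space_hconcat_pair(1)[OF U W] D, symmetric]) auto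
qed

text \<open>\<open>A U\<close> and \<open>A\<^sup>H W\<close> have their columns in the range of \<open>\<Delta>(A)\<close>, which is the column space of \<open>[U, W]\<close>.
  So \<open>S U = A U - H U\<close> and \<open>S W = H W - A\<^sup>H W\<close> need one step of \<open>H\<close> only. The commutator is
  \<open>\<Delta>(A) / 2\<close>, with values in the same column space.\<close>

lemma antihermitian_part_mult_block_krylov:
  assumes v: "v \<in> block_krylov n (hermitian_part A) (hconcat n [U, W]) j"
  shows "antihermitian_part A *\<^sub>v v \<in> block_krylov n (hermitian_part A) (hconcat n [U, W]) (Suc j)"
proof -
  let ?H = "hermitian_part A" and ?S = "antihermitian_part A" and ?Z = "hconcat n [U, W]"
  note aA = mat_adjoint_carrier[OF A]
  note H = parts_carrier(1)[OF A] and S = parts_carrier(2)[OF A]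
  note Z = col_space_hconcat_pair(1)[OF U W] and Z_cols = col_space_hconcat_pair(2)[OF U W]
  have K2: "col_space ?Z \<subseteq> block_krylov n ?H ?Z 2"
    using col_space_subset_block_krylov[OF H Z, of 1] by (simp add: numeral_2_eq_2)
  show ?thesis
  proof (rule mult_block_krylov_if_commutator_in_col_space[OF H Z S _ _ v])
    fix z assume z: "z \<in> set (cols ?Z)"
    then have "z \<in> col_space ?Z" using cols_subset_col_space[OF Z] by blast
    then have Hz: "?H *\<^sub>v z \<in> block_krylov n ?H ?Z 2"
      using mult_block_krylov[OF H Z] unfolding block_krylov_1[OF H Z, symmetric]
      by (auto simp: numeral_2_eq_2)
    have zc: "z \<in> carrier_vec n" using z cols_carrier[OF Z] by blast
    from z consider "z \<in> set (cols U)" | "z \<in> set (cols W)" unfolding Z_cols by blast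
    then show "?S *\<^sub>v z \<in> block_krylov n ?H ?Z 2"
    proof cases
      case 1
      then have "A *\<^sub>v z \<in> set (cols (hconcat n [U, A * U]))"
        unfolding col_space_hconcat_pair(2)[OF U mult_carrier_mat[OF A U]] set_cols_mult[OF A U] by blast
      then have "A *\<^sub>v z \<in> col_space ?Z"
        using cols_subset_col_space[OF col_space_hconcat_pair(1)[OF U mult_carrier_mat[OF A U]]]
        unfolding col_space_Delta(1)[symmetric] col_space_Delta(3) by blast
      moreover have "?S *\<^sub>v z = A *\<^sub>v z - ?H *\<^sub>v z"
        by (rule parts_recombine(3)[OF A zc])
      ultimately show ?thesis using K2 Hz block_krylov_minus[OF H Z] by auto
    next
      case 2
      then have "mat_adjoint A *\<^sub>v z \<in> set (cols (hconcat n [W, mat_adjoint A * W]))"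
        unfolding col_space_hconcat_pair(2)[OF W mult_carrier_mat[OF aA W]] set_cols_mult[OF aA W] by blast
      then have "mat_adjoint A *\<^sub>v z \<in> col_space ?Z"
        using cols_subset_col_space[OF col_space_hconcat_pair(1)[OF W mult_carrier_mat[OF aA W]]]
        unfolding col_space_Delta(2)[symmetric] col_space_Delta(3) by blast
      moreover have "?S *\<^sub>v z = ?H *\<^sub>v z - mat_adjoint A *\<^sub>v z"
        by (rule parts_recombine(4)[OF A zc])
      ultimately show ?thesis using K2 Hz block_krylov_minus[OF H Z] by auto
    qed
  next
    fix x :: "complex vec" assume x: "x \<in> carrier_vec n"
    have "Delta A *\<^sub>v x \<in> col_space ?Z"
      using mult_mat_vec_in_col_space[OF Delta_carrier[OF A] x] unfolding col_space_Delta(3) .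
    then have "Delta A *\<^sub>v x \<in> span (set (cols ?Z))" unfolding col_space_def .
    then show "?H *\<^sub>v (?S *\<^sub>v x) - ?S *\<^sub>v (?H *\<^sub>v x) \<in> col_space ?Z"
      unfolding commutator_parts[OF A x] col_space_def by (rule smult_in_span[OF cols_carrier[OF Z]])
  qed
qed

end

end

section \<open>Krylov inclusion and simultaneous block tridiagonal form\<close>

theorem theorem8:
  fixes n :: nat and A U V :: "complex mat"
  assumes "A \<in> carrier_mat n n"
    and "U \<in> carrier_mat n 2"
    and "V \<in> carrier_mat n 2"
    and "almost_normal_with n 2 (U * mat_adjoint V) A"
    and "vec_space.rank n (hconcat n [U, V]) = 4"
    and "vec_space.rank n (Delta A) = 4"
  shows "(\<forall>j. block_krylov n (antihermitian_part A) (hconcat n [U, V]) j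
             \<subseteq> block_krylov n (hermitian_part A) (hconcat n [U, V]) j) \<and>
         (\<forall>Qs. block_lanczos_output n (hermitian_part A) (hconcat n [U, V]) Qs \<longrightarrow>
           (let Q = hconcat n Qs; is = map dim_col Qs in
              unitary_mat n Q \<and>
              block_tridiagonal is (mat_adjoint Q * hermitian_part A * Q) \<and>
              block_tridiagonal is (mat_adjoint Q * antihermitian_part A * Q) \<and>
              block_tridiagonal is (mat_adjoint Q * A * Q) \<and>
              (\<forall>i \<in> set is. i \<le> 4)))"
proof (intro conjI allI impI)
  interpret complex_vec_space n .
  let ?Z = "hconcat n [U, V]" and ?H = "hermitian_part A" and ?S = "antihermitian_part A"
  note A = assms(1) and U = assms(2) and V = assms(3)
  have Z: "?Z \<in> carrier_mat n 4" using col_space_hconcat_pair(1)[OF U V] by simp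
  note H = parts_carrier(1)[OF A] and S = parts_carrier(2)[OF A]
  have comm: "Delta A = U * mat_adjoint V * A - A * (U * mat_adjoint V)"
    using assms(4) unfolding almost_normal_with_def by blast
  have multH: "?H *\<^sub>v v \<in> block_krylov n ?H ?Z (Suc j)" if "v \<in> block_krylov n ?H ?Z j" for j v
    using that by (rule mult_block_krylov[OF H Z])
  have multS: "?S *\<^sub>v v \<in> block_krylov n ?H ?Z (Suc j)" if "v \<in> block_krylov n ?H ?Z j" for j v
    using assms(5,6) that by (intro antihermitian_part_mult_block_krylov[OF A U V comm]) simp_all
  show "block_krylov n ?S ?Z j \<subseteq> block_krylov n ?H ?Z j" for j
    by (rule block_krylov_subset_if_mult[OF H S Z multS])
  have sum: "A *\<^sub>v v = ?H *\<^sub>v v + ?S *\<^sub>v v" "mat_adjoint A *\<^sub>v v = ?H *\<^sub>v v - ?S *\<^sub>v v"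
    "mat_adjoint ?S *\<^sub>v v = (-1) \<cdot>\<^sub>v (?S *\<^sub>v v)"
    if "v \<in> block_krylov n ?H ?Z j" for j v
  proof -
    have v: "v \<in> carrier_vec n" using that block_krylov_carrier[OF H Z] by blast
    show "A *\<^sub>v v = ?H *\<^sub>v v + ?S *\<^sub>v v" "mat_adjoint A *\<^sub>v v = ?H *\<^sub>v v - ?S *\<^sub>v v"
      by (rule parts_recombine[OF A v])+
    show "mat_adjoint ?S *\<^sub>v v = (-1) \<cdot>\<^sub>v (?S *\<^sub>v v)"
      unfolding mat_adjoint_parts(2)[OF A] by (rule smult_mat_mult_vec[OF S v])
  qed
  fix Qs assume out: "block_lanczos_output n ?H ?Z Qs"
  let ?Q = "hconcat n Qs" and ?is = "map dim_col Qs"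
  have run: "krylov_blocks ?H ?Z Qs" "\<forall>Q\<in>set Qs. dim_col Q \<le> 4"
    using block_lanczos_krylov_blocks[OF _ H mat_adjoint_parts(1)[OF A] Z, of Qs] out
    unfolding block_lanczos_output_def by auto
  have "unitary_mat n ?Q"
    using hconcat_blocks_unitary(2)[of Qs] run(1) out
    unfolding krylov_blocks_def block_lanczos_output_def by simp
  moreover have "block_tridiagonal ?is (mat_adjoint ?Q * ?H * ?Q)"
    using multH by (intro krylov_blocks_block_tridiagonal[OF run(1) H]) (simp_all add: mat_adjoint_parts[OF A])
  moreover have "block_tridiagonal ?is (mat_adjoint ?Q * ?S * ?Q)"
    using multS block_krylov_smult[OF H Z]
    by (intro krylov_blocks_block_tridiagonal[OF run(1) S]) (simp_all add: sum(3))
  moreover have "block_tridiagonal ?is (mat_adjoint ?Q * A * ?Q)"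
    using multS multH block_krylov_add[OF H Z] block_krylov_minus[OF H Z]
    by (intro krylov_blocks_block_tridiagonal[OF run(1) A]) (simp_all add: sum(1,2))
  ultimately show "let Q = ?Q; is = ?is in unitary_mat n Q \<and>
      block_tridiagonal is (mat_adjoint Q * ?H * Q) \<and>
      block_tridiagonal is (mat_adjoint Q * ?S * Q) \<and>
      block_tridiagonal is (mat_adjoint Q * A * Q) \<and> (\<forall>i\<in>set is. i \<le> 4)"
    using run(2) unfolding Let_def by simp
qed

end
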